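(* Let $\bar{\mathbf A}_n^M$ be the normal matrix described in the context, associated with a complete orthonormal basis $\{\psi_k\}_{k\ge1}$ of $L^2_\rho([0,1])$ that is uniformly bounded, $C_{\max}:=\sup_{k\ge1}\|\psi_k\|_\infty<\infty$, and let $\bar{\mathcal L}$ be coercive on $L^2_\rho$ with constant $c_{\bar{\mathcal L}}>0$. Then for any $\varepsilon\in(0,1)$, $$\mathbb P\big\{\lambda_{\min}(\bar{\mathbf A}_n^M)\le(1-\varepsilon)c_{\bar{\mathcal L}}\big\}\le n\left[\frac{e^{-\varepsilon}}{(1-\varepsilon)^{1-\varepsilon}}\right]^{\frac{c_{\bar{\mathcal L}}M}{nC_{\max}^2}}.$$ In particular, $$\mathbb P\Big\{\lambda_{\min}(\bar{\mathbf A}_n^M)\le\frac{c_{\bar{\mathcal L}}}2\Big\}\le n\left[\frac e2\right]^{-\frac{c_{\bar{\mathcal L}}M}{2nC_{\max}^2}}.$$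
   Context: Fix integers $N\ge3$, $d\ge1$. Let $X=(X_1,\dots,X_N)$ with $X_i$ random in $\mathbb R^d$, satisfying: (A1) $X_1,\dots,X_N$ are exchangeable with finite mean; (A2) for each pair $\{X_i-X_j,X_i-X_{j'}\}$ with $j\ne j'$ and $j,j'\ne i$ there is a $\sigma$-algebra given which the pair is conditionally independent; (A3) each such pair has a continuous joint probability density. Let $X^1,\dots,X^M$ be i.i.d. samples of $X$. For $\phi:\mathbb R^+\to\mathbb R$ let $R_\phi[X]=(R_\phi[X]_1,\dots,R_\phi[X]_N)\in\mathbb R^{Nd}$ with $R_\phi[X]_i=\frac1{N-1}\sum_{j\ne i}\phi(\|X_i-X_j\|)\frac{X_i-X_j}{\|X_i-X_j\|}$. The exploration measure $\rho$ is the law of $\|X_1-X_2\|$; it has a continuous density $\rho'$ with $[0,1]\subseteq\operatorname{supp}(\rho')$. Write $L^2_\rho=L^2_\rho([0,1])$; functions on $[0,1]$ are extended by zero when inserted in $R_\phi$. The normal operator $\bar{\mathcal L}:L^2_\rho\to L^2_\rho$ is given by $\langle\bar{\mathcal L}\phi,\psi\rangle_{L^2_\rho}=\frac1N\sum_{i=1}^N\mathbb E[\langle R_\phi[X]_i,R_\psi[X]_i\rangle_{\mathbb R^d}]$, and is coercive with constant $c_{\bar{\mathcal L}}>0$ if $\langle\bar{\mathcal L}\phi,\phi\rangle_{L^2_\rho}\ge c_{\bar{\mathcal L}}\|\phi\|_{L^2_\rho}^2$ for all $\phi\in L^2_\rho$. The normal matrix $\bar{\mathbf A}_n^M\in\mathbb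 R^{n\times n}$ has entries $\bar{\mathbf A}_n^M(k,l)=\frac1{MN}\sum_{m=1}^M\langle R_{\psi_k}[X^m],R_{\psi_l}[X^m]\rangle_{\mathbb R^{Nd}}$, $1\le k,l\le n$; $\lambda_{\min}$ denotes its smallest eigenvalue. *)

theory Defs
  imports "HOL-Probability.Probability" "Jordan_Normal_Form.Spectral_Radius"
begin

text \<open>
  A family \<open>X 1, ..., X N\<close> of random vectors is a function \<open>X\<close> of type
  \<open>nat \<Rightarrow> 'a \<Rightarrow> 'e\<close>; only the indices in \<open>{1..N}\<close> matter.  Its joint law lives on the product
  space below.
\<close>

abbreviation config_space :: "nat \<Rightarrow> (nat \<Rightarrow> 'e::euclidean_space) measure" where
  "config_space N \<equiv> PiM {1..N} (\<lambda>_. borel)"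

definition joint :: "nat \<Rightarrow> (nat \<Rightarrow> 'a \<Rightarrow> 'e) \<Rightarrow> 'a \<Rightarrow> nat \<Rightarrow> 'e" where
  "joint N X \<omega> = (\<lambda>i\<in>{1..N}. X i \<omega>)"

definition exchangeable ::
    "'a measure \<Rightarrow> nat \<Rightarrow> (nat \<Rightarrow> 'a \<Rightarrow> 'e::euclidean_space) \<Rightarrow> bool" where
  "exchangeable P N X \<longleftrightarrow>
     (\<forall>i\<in>{1..N}. X i \<in> borel_measurable P) \<and>
     (\<forall>\<pi>. \<pi> permutes {1..N} \<longrightarrow>
        distr P (config_space N) (joint N (\<lambda>i. X (\<pi> i))) = distr P (config_space N) (joint N X))"

definition cond_indep ::
    "'a measure \<Rightarrow> 'a measure \<Rightarrow> ('a \<Rightarrow> 'b::topological_space) \<Rightarrow> ('a \<Rightarrow> 'c::topological_space) \<Rightarrow> bool"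
  where
  "cond_indep P F U V \<longleftrightarrow>
     (\<forall>A\<in>sets borel. \<forall>B\<in>sets borel. AE \<omega> in P.
        real_cond_exp P F (\<lambda>\<omega>'. indicator A (U \<omega>') * indicator B (V \<omega>')) \<omega>
      = real_cond_exp P F (\<lambda>\<omega>'. indicator A (U \<omega>')) \<omega>
        * real_cond_exp P F (\<lambda>\<omega>'. indicator B (V \<omega>')) \<omega>)"

definition has_continuous_density ::
    "'a measure \<Rightarrow> ('a \<Rightarrow> 'b::euclidean_space) \<Rightarrow> bool" where
  "has_continuous_density P Z \<longleftrightarrow>
     (\<exists>f. continuous_on UNIV f \<and> (\<forall>z. 0 \<le> f z) \<and> distributed P lborel Z (\<lambda>z. ennreal (f z)))"

definition admissible ::
    "'a measure \<Rightarrow> nat \<Rightarrow> (nat \<Rightarrow> 'a \<Rightarrow> 'e::euclidean_space) \<Rightarrow> bool" where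
  "admissible P N X \<longleftrightarrow>
     exchangeable P N X \<and> (\<forall>i\<in>{1..N}. integrable P (X i)) \<and>
     (\<forall>i\<in>{1..N}. \<forall>j\<in>{1..N}. \<forall>j'\<in>{1..N}. j \<noteq> j' \<and> j \<noteq> i \<and> j' \<noteq> i \<longrightarrow>
        (\<exists>F. subalgebra P F \<and>
             cond_indep P F (\<lambda>\<omega>. X i \<omega> - X j \<omega>) (\<lambda>\<omega>. X i \<omega> - X j' \<omega>)) \<and>
        has_continuous_density P (\<lambda>\<omega>. (X i \<omega> - X j \<omega>, X i \<omega> - X j' \<omega>)))"

definition iid_copies ::
    "'a measure \<Rightarrow> nat \<Rightarrow> (nat \<Rightarrow> 'a \<Rightarrow> 'e::euclidean_space) \<Rightarrow> nat \<Rightarrow> (nat \<Rightarrow> nat \<Rightarrow> 'a \<Rightarrow> 'e) \<Rightarrow> bool"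
  where
  "iid_copies P N X M Xs \<longleftrightarrow>
     prob_space.indep_vars P (\<lambda>_. config_space N) (\<lambda>m. joint N (Xs m)) {1..M} \<and>
     (\<forall>m\<in>{1..M}. distr P (config_space N) (joint N (Xs m)) = distr P (config_space N) (joint N X))"

definition exploration_measure :: "'a measure \<Rightarrow> (nat \<Rightarrow> 'a \<Rightarrow> 'e::euclidean_space) \<Rightarrow> real measure" where
  "exploration_measure P X = distr P borel (\<lambda>\<omega>. norm (X 1 \<omega> - X 2 \<omega>))"

text \<open>
  The exploration measure lives on the half-line, so its density is required to be continuous
  there; for \<open>d = 1\<close> the extension by zero to the negative reals may jump at the origin.
\<close>

definition exploration_regular :: "'a measure \<Rightarrow> (nat \<Rightarrow> 'a \<Rightarrow> 'e::euclidean_space) \<Rightarrow> bool" where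
  "exploration_regular P X \<longleftrightarrow>
     (\<exists>p. continuous_on {0..} p \<and> (\<forall>r\<ge>0. 0 \<le> p r) \<and>
          distributed P lborel (\<lambda>\<omega>. norm (X 1 \<omega> - X 2 \<omega>))
            (\<lambda>r. ennreal (p r * indicator {0..} r)) \<and>
          {0..1} \<subseteq> closure {r \<in> {0..}. p r \<noteq> 0})"

text \<open>
  Elements of \<open>L\<^sup>2\<^sub>\<rho>([0,1])\<close> are given by representatives, whose values outside
  \<open>[0,1]\<close> are irrelevant; equality in the space is equality \<open>\<rho>\<close>-almost everywhere on \<open>[0,1]\<close>.
\<close>

abbreviation on_unit :: "real measure \<Rightarrow> real measure" where
  "on_unit \<rho> \<equiv> restrict_space \<rho> {0..1}"

definition L2_space :: "real measure \<Rightarrow> (real \<Rightarrow> real) set" where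
  "L2_space \<rho> = {f \<in> borel_measurable (on_unit \<rho>). integrable (on_unit \<rho>) (\<lambda>r. (f r)\<^sup>2)}"

definition L2_inner :: "real measure \<Rightarrow> (real \<Rightarrow> real) \<Rightarrow> (real \<Rightarrow> real) \<Rightarrow> real" where
  "L2_inner \<rho> f g = (LINT r|on_unit \<rho>. f r * g r)"

definition L2_norm :: "real measure \<Rightarrow> (real \<Rightarrow> real) \<Rightarrow> real" where
  "L2_norm \<rho> f = sqrt (L2_inner \<rho> f f)"

definition Linf_norm :: "real measure \<Rightarrow> (real \<Rightarrow> real) \<Rightarrow> ereal" where
  "Linf_norm \<rho> f = esssup (on_unit \<rho>) (\<lambda>r. ereal \<bar>f r\<bar>)"

definition orthonormal_basis :: "real measure \<Rightarrow> (nat \<Rightarrow> real \<Rightarrow> real) \<Rightarrow> bool" where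
  "orthonormal_basis \<rho> \<psi> \<longleftrightarrow>
     (\<forall>k\<ge>1. \<psi> k \<in> L2_space \<rho>) \<and>
     (\<forall>k\<ge>1. \<forall>l\<ge>1. L2_inner \<rho> (\<psi> k) (\<psi> l) = (if k = l then 1 else 0)) \<and>
     (\<forall>f\<in>L2_space \<rho>.
        (\<lambda>K. L2_norm \<rho> (\<lambda>r. f r - (\<Sum>k=1..K. L2_inner \<rho> f (\<psi> k) * \<psi> k r))) \<longlonglongrightarrow> 0)"

definition zero_ext :: "(real \<Rightarrow> real) \<Rightarrow> real \<Rightarrow> real" where
  "zero_ext f r = (if r \<in> {0..1} then f r else 0)"

text \<open>
  A pair at distance zero contributes the zero vector.
\<close>

definition interaction ::
    "nat \<Rightarrow> (real \<Rightarrow> real) \<Rightarrow> (nat \<Rightarrow> 'e::euclidean_space) \<Rightarrow> nat \<Rightarrow> 'e" where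
  "interaction N \<phi> x i =
     (1 / (real N - 1)) *\<^sub>R
     (\<Sum>j\<in>{1..N} - {i}. \<phi> (norm (x i - x j)) *\<^sub>R ((x i - x j) /\<^sub>R norm (x i - x j)))"

text \<open>
  The operator is determined by its bilinear form up to \<open>\<rho>\<close>-null sets, hence only described up
  to the choice of representatives.  Linearity and boundedness follow from the defining identity.
\<close>

definition normal_operator ::
    "'a measure \<Rightarrow> nat \<Rightarrow> (nat \<Rightarrow> 'a \<Rightarrow> 'e::euclidean_space) \<Rightarrow>
     ((real \<Rightarrow> real) \<Rightarrow> real \<Rightarrow> real) \<Rightarrow> bool" where
  "normal_operator P N X L \<longleftrightarrow>
     (let \<rho> = exploration_measure P X in
      (\<forall>\<phi>\<in>L2_space \<rho>. L \<phi> \<in> L2_space \<rho>) \<and>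
      (\<forall>\<phi>\<in>L2_space \<rho>. \<forall>\<psi>\<in>L2_space \<rho>.
         L2_inner \<rho> (L \<phi>) \<psi> =
         (1 / real N) * (\<Sum>i=1..N. LINT \<omega>|P.
            inner (interaction N (zero_ext \<phi>) (\<lambda>i. X i \<omega>) i)
                  (interaction N (zero_ext \<psi>) (\<lambda>i. X i \<omega>) i))))"

definition coercive :: "real measure \<Rightarrow> ((real \<Rightarrow> real) \<Rightarrow> real \<Rightarrow> real) \<Rightarrow> real \<Rightarrow> bool" where
  "coercive \<rho> L c \<longleftrightarrow>
     0 < c \<and> (\<forall>\<phi>\<in>L2_space \<rho>. L2_inner \<rho> (L \<phi>) \<phi> \<ge> c * (L2_norm \<rho> \<phi>)\<^sup>2)"

text \<open>
  Matrix indices start at 0, the basis is indexed from 1.  The inner product of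
  \<open>\<real>\<close> to the power \<open>N * d\<close> is the sum over the \<open>N\<close> blocks of dimension \<open>d\<close>.
\<close>

definition normal_matrix ::
    "nat \<Rightarrow> nat \<Rightarrow> nat \<Rightarrow> (nat \<Rightarrow> real \<Rightarrow> real) \<Rightarrow> (nat \<Rightarrow> nat \<Rightarrow> 'e::euclidean_space) \<Rightarrow> real mat" where
  "normal_matrix N M n \<psi> x =
     mat n n (\<lambda>(k, l). 1 / (real M * real N) *
       (\<Sum>m=1..M. \<Sum>i=1..N.
          inner (interaction N (zero_ext (\<psi> (Suc k))) (x m) i)
                (interaction N (zero_ext (\<psi> (Suc l))) (x m) i)))"

definition lambda_min :: "real mat \<Rightarrow> real" where
  "lambda_min A = Min (spectrum A)"

end

theory Submission
  imports Defs
begin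

text \<open>
  The normal matrix is the average of \<open>M\<close> independent Gram matrices \<open>A\<^sub>1, ..., A\<^sub>M\<close>, one for
  each sample.  For a coefficient vector \<open>v\<close> put \<open>\<phi> = \<Sum>\<^sub>k v\<^sub>k \<psi>\<^sub>k\<close>.  The form of \<open>A\<^sub>m\<close> at \<open>v\<close> is the
  mean over the particles of the squared interaction with kernel \<open>\<phi>\<close>; as an interaction averages
  vectors of length at most \<open>sup \<bar>\<phi>\<bar>\<close>, and \<open>sup \<bar>\<phi>\<bar>\<close> is at most the square root of \<open>n\<close>
  times \<open>C_max \<bar>v\<bar>\<close>, one has \<open>0 \<le> A\<^sub>m \<le> R\<close> with \<open>R = n C_max\<^sup>2\<close>.
  Its expectation is \<open>\<langle>L \<phi>, \<phi>\<rangle> \<ge> c \<bar>\<phi>\<bar>\<^sup>2 = c \<bar>v\<bar>\<^sup>2\<close> by coercivity and orthonormality.  So the theorem is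
  the lower Chernoff tail for sums of independent positive semidefinite matrices, with mean at
  least \<open>c\<close> and upper bound \<open>R\<close> (\<open>matrix_Chernoff_lower_tail\<close>).

  The potential that controls the smallest eigenvalue of \<open>S = A\<^sub>1 + ... + A\<^sub>M\<close> is \<open>tr B\<^sup>K\<close> with
  \<open>B = 1 - (\<theta> / K) S\<close>, a polynomial approximation of \<open>tr exp (- \<theta> S)\<close> that becomes exact as \<open>K\<close> tends
  to infinity.  To see how the trace changes when one more summand \<open>C\<close> (scaled by \<open>\<theta> / K\<close>) is subtracted,
  move along \<open>B - s C\<close>: the derivative of the trace is \<open>- K g(s)\<close> with \<open>g(s) = tr (C (B - s C)\<^sup>K\<^sup>-\<^sup>1)\<close>.  The
  derivative of \<open>g\<close> consists of terms \<open>tr (C B\<^sup>a C B\<^sup>b)\<close>, and these are at most \<open>tr (C B\<^sup>a\<^sup>+\<^sup>b C)\<close>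
  (\<open>tr_interleave_le\<close>), because the trace is convex in \<open>a\<close> when \<open>a + b\<close> is kept fixed and takes the
  same value at both ends.  With \<open>C\<^sup>2 \<le> r C\<close> this becomes the differential inequality
  \<open>g' \<ge> - \<kappa> g\<close>, so \<open>g\<close> decays at most exponentially, and integration bounds the decrease of the
  trace from below (\<open>tr_pow_minus_le\<close>).

  Independence turns this into a factor \<open>1 - (c / R) (1 - exp (- \<theta> R))\<close>, up to an error that
  vanishes as \<open>K\<close> grows, for the expected trace in every step (\<open>expectation_tr_pow_le\<close>).  An eigenvalue of
  \<open>S\<close> below \<open>t\<close> forces \<open>tr B\<^sup>K\<close> above about \<open>(1 - \<theta> t / K)\<^sup>K\<close>, so Markov's inequality and \<open>K \<rightarrow> \<infinity>\<close>
  give an exponential bound (\<open>tail_le_exp\<close>), which \<open>\<theta> = - ln (1 - \<epsilon>) / R\<close> optimises.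

  The exponent \<open>K\<close> is odd throughout.  Then \<open>B\<^sup>K\<^sup>-\<^sup>1\<close> is the square of a symmetric matrix, and
  the positivity of every trace that occurs can be read off from quadratic forms.
\<close>

unbundle no inner_syntax

section \<open>Traces and the Loewner order\<close>

definition tr :: "real mat \<Rightarrow> real" where
  "tr A = (\<Sum>i<dim_row A. A $$ (i, i))"

definition sym_mats :: "nat \<Rightarrow> real mat set" where
  "sym_mats n = {A \<in> carrier_mat n n. transpose_mat A = A}"

definition loewner_le :: "nat \<Rightarrow> real mat \<Rightarrow> real mat \<Rightarrow> bool" where
  "loewner_le n A B \<longleftrightarrow>
     (\<forall>v\<in>carrier_vec n. v \<bullet> (A *\<^sub>v v) \<le> v \<bullet> (B *\<^sub>v v))"

lemma sym_mats_carrier: "A \<in> sym_mats n \<Longrightarrow> A \<in> carrier_mat n n"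
  and sym_mats_transpose: "A \<in> sym_mats n \<Longrightarrow> transpose_mat A = A"
  by (auto simp: sym_mats_def)

lemma sym_matsI: "A \<in> carrier_mat n n \<Longrightarrow> transpose_mat A = A \<Longrightarrow> A \<in> sym_mats n"
  by (auto simp only: sym_mats_def mem_Collect_eq)

context
  fixes n :: nat
begin

text \<open>With the dimension fixed, the side conditions of matrix algebra become simplification rules
  without free dimension parameters.\<close>

lemma closed_ops [simp]:
  fixes A B :: "real mat"
  assumes "A \<in> carrier_mat n n"
  shows "B \<in> carrier_mat n n \<Longrightarrow> A * B \<in> carrier_mat n n"
    and "B \<in> carrier_mat n n \<Longrightarrow> A - B \<in> carrier_mat n n"
    and "c \<cdot>\<^sub>m A \<in> carrier_mat n n"
    and "v \<in> carrier_vec n \<Longrightarrow> A *\<^sub>v v \<in> carrier_vec n"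
  using assms by auto

lemma sym_closed [simp]: "A \<in> sym_mats n \<Longrightarrow> A \<in> carrier_mat n n"
  by (rule sym_mats_carrier)

lemma mat_assoc:
  fixes A B C :: "real mat"
  assumes "A \<in> carrier_mat n n" "B \<in> carrier_mat n n" "C \<in> carrier_mat n n"
  shows "A * B * C = A * (B * C)"
  using assms by (rule assoc_mult_mat)

lemma one_mult_mat [simp]:
  fixes A :: "real mat"
  assumes "A \<in> carrier_mat n n"
  shows "1\<^sub>m n * A = A" "A * 1\<^sub>m n = A"
  using assms by auto

lemma smult_mult_mat [simp]:
  fixes A B :: "real mat"
  assumes "A \<in> carrier_mat n n" "B \<in> carrier_mat n n"
  shows "(c \<cdot>\<^sub>m A) * B = c \<cdot>\<^sub>m (A * B)" "A * (c \<cdot>\<^sub>m B) = c \<cdot>\<^sub>m (A * B)"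
  using mult_smult_assoc_mat[OF assms] mult_smult_distrib[OF assms] by auto

lemma zero_mat_mult_vec [simp]: "v \<in> carrier_vec n \<Longrightarrow> 0\<^sub>m n n *\<^sub>v v = (0\<^sub>v n :: real vec)"
  by (intro eq_vecI) auto

lemma scaled_one_mult_vec [simp]:
  "v \<in> carrier_vec n \<Longrightarrow> (r \<cdot>\<^sub>m 1\<^sub>m n) *\<^sub>v v = r \<cdot>\<^sub>v (v :: real vec)"
  by (intro eq_vecI) auto

lemma smult_mat_mult_vec [simp]:
  fixes A :: "real mat"
  shows "A \<in> carrier_mat n n \<Longrightarrow> v \<in> carrier_vec n \<Longrightarrow> (c \<cdot>\<^sub>m A) *\<^sub>v v = c \<cdot>\<^sub>v (A *\<^sub>v v)"
  by (intro eq_vecI) (auto simp: scalar_prod_def sum_distrib_left mult.assoc)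

lemma minus_mat_mult_vec [simp]:
  fixes A B :: "real mat"
  shows "A \<in> carrier_mat n n \<Longrightarrow> B \<in> carrier_mat n n \<Longrightarrow> v \<in> carrier_vec n
    \<Longrightarrow> (A - B) *\<^sub>v v = A *\<^sub>v v - B *\<^sub>v v"
  by (intro eq_vecI) (auto simp: scalar_prod_def left_diff_distrib sum_subtractf)

lemma psd_iff: "loewner_le n (0\<^sub>m n n) A \<longleftrightarrow> (\<forall>v\<in>carrier_vec n. 0 \<le> v \<bullet> (A *\<^sub>v v))"
  by (simp add: loewner_le_def)

lemma tr_minus:
  "A \<in> carrier_mat n n \<Longrightarrow> B \<in> carrier_mat n n \<Longrightarrow> tr (A - B) = tr A - tr B"
  by (auto simp: tr_def sum_subtractf)

lemma tr_smult: "A \<in> carrier_mat n n \<Longrightarrow> tr (c \<cdot>\<^sub>m A) = c * tr A"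
  by (auto simp: tr_def sum_distrib_left)

lemma tr_one: "tr (1\<^sub>m n) = real n"
  by (simp add: tr_def)

lemma tr_mult:
  assumes "A \<in> carrier_mat n n" "B \<in> carrier_mat n n"
  shows "tr (A * B) = (\<Sum>i<n. \<Sum>j<n. A $$ (i, j) * B $$ (j, i))"
  using assms by (auto simp: tr_def scalar_prod_def atLeast0LessThan intro!: sum.cong)

lemma tr_mult_comm:
  assumes "A \<in> carrier_mat n n" "B \<in> carrier_mat n n"
  shows "tr (A * B) = tr (B * A)"
  unfolding tr_mult[OF assms] tr_mult[OF assms(2,1)]
  by (subst sum.swap) (simp add: mult.commute)

lemma pow_mat_add:
  assumes "A \<in> carrier_mat n n"
  shows "A ^\<^sub>m (a + b) = A ^\<^sub>m a * A ^\<^sub>m b"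
proof (induction b)
  case (Suc b)
  have "A ^\<^sub>m (a + Suc b) = A ^\<^sub>m a * A ^\<^sub>m b * A"
    using Suc by simp
  also have "\<dots> = A ^\<^sub>m a * (A ^\<^sub>m b * A)"
    by (rule assoc_mult_mat) (use assms in auto)
  finally show ?case by simp
next
  case 0
  have "A ^\<^sub>m a \<in> carrier_mat n n" using assms by simp
  then show ?case using assms by auto
qed

lemma pow_mat_commute:
  assumes "A \<in> carrier_mat n n"
  shows "A ^\<^sub>m a * A = A * A ^\<^sub>m a"
proof -
  have one: "A ^\<^sub>m 1 = A" using assms by simp
  have "A ^\<^sub>m a * A ^\<^sub>m 1 = A ^\<^sub>m 1 * A ^\<^sub>m a"
    unfolding pow_mat_add[OF assms, symmetric] by (simp only: add.commute)
  then show ?thesis unfolding one .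
qed

lemma sym_mats_pow [simp]:
  assumes "A \<in> sym_mats n"
  shows "A ^\<^sub>m k \<in> sym_mats n"
proof (induction k)
  case (Suc k)
  have "transpose_mat (A ^\<^sub>m k * A) = A * A ^\<^sub>m k"
    using Suc assms by (subst transpose_mult[of _ n n _ n]) (auto simp: sym_mats_transpose)
  then have "transpose_mat (A ^\<^sub>m Suc k) = A ^\<^sub>m Suc k"
    using pow_mat_commute[of A k] assms by simp
  then show ?case
    using assms by (intro sym_matsI) auto
next
  case 0
  then show ?case
    using assms by (intro sym_matsI) (auto simp: carrier_matD[OF sym_mats_carrier[OF assms]])
qed

lemma sym_mats_minus [simp]: "A \<in> sym_mats n \<Longrightarrow> B \<in> sym_mats n \<Longrightarrow> A - B \<in> sym_mats n"
  by (intro sym_matsI) (simp_all add: transpose_minus[of _ n n] sym_mats_transpose)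

lemma sym_mats_smult [simp]: "A \<in> sym_mats n \<Longrightarrow> c \<cdot>\<^sub>m A \<in> sym_mats n"
  by (intro sym_matsI) (simp_all add: smult_mat_def map_mat_transpose sym_mats_transpose)

lemma quad_transpose:
  fixes Y :: "real mat"
  assumes "Y \<in> carrier_mat n n" "u \<in> carrier_vec n" "v \<in> carrier_vec n"
  shows "u \<bullet> (transpose_mat Y *\<^sub>v v) = (Y *\<^sub>v u) \<bullet> v"
proof -
  have "u \<bullet> (transpose_mat Y *\<^sub>v v) = (transpose_mat Y *\<^sub>v v) \<bullet> u"
    using assms by (intro comm_scalar_prod[of _ n]) auto
  also have "\<dots> = v \<bullet> (Y *\<^sub>v u)"
    by (rule transpose_vec_mult_scalar[OF assms])
  also have "\<dots> = (Y *\<^sub>v u) \<bullet> v"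
    using assms by (intro comm_scalar_prod[of _ n]) auto
  finally show ?thesis .
qed

text \<open>The trace of \<open>Y\<^sup>T P Y\<close> adds up the values of the quadratic form of \<open>P\<close> on the columns of \<open>Y\<close>.
  Most inequalities between traces below come from here.\<close>

lemma tr_congruence_mono:
  assumes Y: "Y \<in> carrier_mat n n" and P: "P \<in> carrier_mat n n" and Q: "Q \<in> carrier_mat n n"
    and le: "loewner_le n P Q"
  shows "tr (transpose_mat Y * P * Y) \<le> tr (transpose_mat Y * Q * Y)"
proof -
  have eq: "tr (transpose_mat Y * P * Y) = (\<Sum>i<n. col Y i \<bullet> (P *\<^sub>v col Y i))"
    if P: "P \<in> carrier_mat n n" for P
  proof -
    have "transpose_mat Y * P * Y = transpose_mat Y * (P * Y)"
      using P Y by (simp add: assoc_mult_mat[of _ n n _ n _ n])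
    then show ?thesis
      unfolding tr_def using P Y by (auto intro!: sum.cong simp: col_mult2[of P n n Y n] simp del: col_mult)
  qed
  show ?thesis
    unfolding eq[OF P] eq[OF Q] using le Y
    by (intro sum_mono) (auto simp: loewner_le_def)
qed

lemma loewner_congruence_mono:
  assumes Y: "Y \<in> carrier_mat n n" and P: "P \<in> carrier_mat n n" and Q: "Q \<in> carrier_mat n n"
    and le: "loewner_le n P Q"
  shows "loewner_le n (transpose_mat Y * P * Y) (transpose_mat Y * Q * Y)"
proof -
  have eq: "v \<bullet> ((transpose_mat Y * P * Y) *\<^sub>v v) = (Y *\<^sub>v v) \<bullet> (P *\<^sub>v (Y *\<^sub>v v))"
    if "P \<in> carrier_mat n n" "v \<in> carrier_vec n" for P v
    using that Y
    by (simp add: assoc_mult_mat[of _ n n _ n _ n] assoc_mult_mat_vec[of _ n n _ n] quad_transpose)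
  show ?thesis
    using le Y unfolding loewner_le_def by (simp add: eq[OF P] eq[OF Q])
qed

text \<open>The form of \<open>A\<close> at \<open>u + t v\<close> is a quadratic polynomial in \<open>t\<close> without negative values, so its
  discriminant is at most zero.\<close>

lemma psd_Cauchy_Schwarz:
  assumes A: "A \<in> sym_mats n" and psd: "loewner_le n (0\<^sub>m n n) A"
    and u: "u \<in> carrier_vec n" and v: "v \<in> carrier_vec n"
  shows "(u \<bullet> (A *\<^sub>v v))\<^sup>2 \<le> (u \<bullet> (A *\<^sub>v u)) * (v \<bullet> (A *\<^sub>v v))"
proof -
  define a b d where "a = u \<bullet> (A *\<^sub>v u)" and "b = u \<bullet> (A *\<^sub>v v)" and "d = v \<bullet> (A *\<^sub>v v)"
  have vu: "v \<bullet> (A *\<^sub>v u) = b"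
    using quad_transpose[of A v u] A u v unfolding b_def
    by (metis comm_scalar_prod mult_mat_vec_carrier sym_mats_carrier sym_mats_transpose)
  have nonneg: "0 \<le> a + 2 * t * b + t\<^sup>2 * d" for t
  proof -
    have "0 \<le> (u + t \<cdot>\<^sub>v v) \<bullet> (A *\<^sub>v (u + t \<cdot>\<^sub>v v))"
      using psd u v unfolding psd_iff by simp
    also have "\<dots> = a + 2 * t * b + t\<^sup>2 * d"
      using A u v vu unfolding a_def b_def d_def
      by (simp add: mult_add_distrib_mat_vec[of _ n n] mult_mat_vec[of _ n n]
          add_scalar_prod_distrib[of _ n] scalar_prod_add_distrib[of _ n] power2_eq_square
          algebra_simps)
    finally show ?thesis .
  qed
  have d0: "0 \<le> d" using psd v unfolding psd_iff d_def by auto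
  show ?thesis
  proof (cases "d = 0")
    case True
    have "b = 0"
    proof (rule ccontr)
      assume "b \<noteq> 0"
      \<comment> \<open>For \<open>d = 0\<close> the polynomial is affine in \<open>t\<close>, and this \<open>t\<close> gives it the value \<open>- 1\<close>.\<close>
      then have "2 * (- (a + 1) / (2 * b)) * b = - (a + 1)" by (simp add: field_simps)
      then show False using nonneg[of "- (a + 1) / (2 * b)"] True by simp
    qed
    then show ?thesis using True by (simp add: a_def b_def d_def)
  next
    case False
    have "0 \<le> d * (a + 2 * (-b/d) * b + (-b/d)\<^sup>2 * d)"
      using nonneg[of "-b/d"] d0 by simp
    also have "\<dots> = a * d - b\<^sup>2"
      using False by (simp add: field_simps power2_eq_square)
    finally show ?thesis by (simp add: a_def b_def d_def)
  qed
qed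

text \<open>The Cauchy--Schwarz inequality for the form of \<open>A\<close> with \<open>u = A v\<close> gives
  \<open>\<bar>A v\<bar>\<^sup>4 \<le> \<langle>A v, A (A v)\<rangle> \<langle>v, A v\<rangle> \<le> r \<bar>A v\<bar>\<^sup>2 \<langle>v, A v\<rangle>\<close>, and \<open>\<bar>A v\<bar>\<^sup>2\<close> is the form of \<open>A\<^sup>2\<close>.\<close>

lemma loewner_square_le:
  assumes A: "A \<in> sym_mats n" and psd: "loewner_le n (0\<^sub>m n n) A"
    and le: "loewner_le n A (r \<cdot>\<^sub>m 1\<^sub>m n)"
  shows "loewner_le n (A * A) (r \<cdot>\<^sub>m A)"
  unfolding loewner_le_def
proof
  fix v :: "real vec" assume v: "v \<in> carrier_vec n"
  define w where "w = A *\<^sub>v v"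
  have w: "w \<in> carrier_vec n" using A v by (simp add: w_def)
  define q where "q = v \<bullet> (A *\<^sub>v v)"
  have q0: "0 \<le> q" using psd v unfolding psd_iff q_def by auto
  have ww0: "0 \<le> w \<bullet> w" by (simp add: scalar_prod_def sum_nonneg)
  have ww: "v \<bullet> ((A * A) *\<^sub>v v) = w \<bullet> w"
    using quad_transpose[of A v w] A v w
    by (simp add: w_def assoc_mult_mat_vec[of _ n n _ n] sym_mats_transpose)
  have up: "w \<bullet> (A *\<^sub>v w) \<le> r * (w \<bullet> w)"
  using le w by (force simp: loewner_le_def)
  have "(w \<bullet> w)\<^sup>2 \<le> (w \<bullet> (A *\<^sub>v w)) * q"
    using psd_Cauchy_Schwarz[OF A psd w v] by (simp add: w_def[symmetric] q_def)
  also have "\<dots> \<le> r * (w \<bullet> w) * q"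
    using up q0 by (rule mult_right_mono)
  finally have "(w \<bullet> w) * (w \<bullet> w) \<le> (w \<bullet> w) * (r * q)"
    by (simp add: power2_eq_square algebra_simps)
  then have "w \<bullet> w \<le> r * q \<or> w \<bullet> w = 0"
    using ww0 mult_le_cancel_left_pos[of "w \<bullet> w" "w \<bullet> w" "r * q"] by force
  moreover have "0 \<le> r * q" if "w \<bullet> w = 0"
  proof -
    have "w = 0\<^sub>v n"
      using that w conjugate_square_eq_0_vec[OF w] by simp
    then have "q = 0" using v by (simp add: q_def w_def[symmetric])
    then show ?thesis by simp
  qed
  ultimately have "w \<bullet> w \<le> r * q" by argo
  then show "v \<bullet> ((A * A) *\<^sub>v v) \<le> v \<bullet> ((r \<cdot>\<^sub>m A) *\<^sub>v v)"
    using A v ww by (simp add: q_def)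
qed


lemma psd_congruence:
  assumes Y: "Y \<in> carrier_mat n n" and P: "P \<in> carrier_mat n n" and psd: "loewner_le n (0\<^sub>m n n) P"
  shows "loewner_le n (0\<^sub>m n n) (transpose_mat Y * P * Y)"
    and "0 \<le> tr (transpose_mat Y * P * Y)"
proof -
  have 0: "transpose_mat Y * 0\<^sub>m n n * Y = 0\<^sub>m n n"
    using Y by (simp add: right_mult_zero_mat[of _ n n] left_mult_zero_mat[of _ n n])
  show "loewner_le n (0\<^sub>m n n) (transpose_mat Y * P * Y)"
    using loewner_congruence_mono[OF Y zero_carrier_mat P psd] by (simp add: 0)
  show "0 \<le> tr (transpose_mat Y * P * Y)"
    using tr_congruence_mono[OF Y zero_carrier_mat P psd] by (simp add: 0 tr_def)
qed

text \<open>A power with exponent \<open>2 r\<close> or \<open>2 r + 1\<close> is the congruence by \<open>B\<^sup>r\<close> of the identity or of \<open>B\<close>.\<close>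

lemma psd_pow:
  assumes B: "B \<in> sym_mats n" and psd: "loewner_le n (0\<^sub>m n n) B"
  shows "loewner_le n (0\<^sub>m n n) (B ^\<^sub>m k)"
proof -
  have Bc: "B \<in> carrier_mat n n" using B by simp
  have D: "B ^\<^sub>m r \<in> carrier_mat n n" "transpose_mat (B ^\<^sub>m r) = B ^\<^sub>m r" for r
    using sym_mats_pow[OF B, of r] by (simp_all add: sym_mats_transpose)
  have one: "loewner_le n (0\<^sub>m n n) (1\<^sub>m n)"
    unfolding psd_iff by (auto simp: scalar_prod_def intro!: sum_nonneg)
  show ?thesis
  proof (cases "even k")
    case True
    then obtain r where k: "k = r + r" by (metis evenE mult_2)
    show ?thesis
      using psd_congruence(1)[OF D(1) one_carrier_mat one, of r] D[of r]
      by (simp add: k pow_mat_add[OF Bc] right_mult_one_mat[of _ n n])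
  next
    case False
    then obtain r where k: "k = r + 1 + r" by (metis oddE mult_2 add.commute add.left_commute)
    show ?thesis
      using psd_congruence(1)[OF D(1) Bc psd, of r] D[of r] Bc
      unfolding k pow_mat_add[OF Bc] by (simp add: mat_assoc)
  qed
qed

section \<open>Traces of interleaved powers\<close>

text \<open>One of the two exponents is even.  Splitting that power in two halves and rotating the
  trace makes the product a congruence of the other power.\<close>

lemma tr_sandwich_nonneg:
  assumes B: "B \<in> sym_mats n" and psd: "loewner_le n (0\<^sub>m n n) B"
    and C: "C \<in> carrier_mat n n" and odd: "odd (i + j)"
  shows "0 \<le> tr (B ^\<^sub>m i * C * B ^\<^sub>m j * transpose_mat C)"
proof -
  have Bc: "B \<in> carrier_mat n n" using B by simp
  have D: "B ^\<^sub>m r \<in> carrier_mat n n" "transpose_mat (B ^\<^sub>m r) = B ^\<^sub>m r" for r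
    using sym_mats_pow[OF B, of r] by (simp_all add: sym_mats_transpose)
  have CT: "transpose_mat C \<in> carrier_mat n n" using C by simp
  show ?thesis
  proof (cases "even i")
    case True
    then obtain r where i: "i = r + r" by (metis evenE mult_2)
    have "tr (B ^\<^sub>m i * C * B ^\<^sub>m j * transpose_mat C)
        = tr (B ^\<^sub>m r * (B ^\<^sub>m r * C * B ^\<^sub>m j * transpose_mat C))"
      using C CT D by (simp add: i pow_mat_add[OF Bc] mat_assoc)
    also have "\<dots> = tr (B ^\<^sub>m r * C * B ^\<^sub>m j * transpose_mat C * B ^\<^sub>m r)"
      using C CT D by (intro tr_mult_comm) auto
    also have "\<dots> = tr (transpose_mat (transpose_mat C * B ^\<^sub>m r) * B ^\<^sub>m j * (transpose_mat C * B ^\<^sub>m r))"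
      using C CT D by (simp add: transpose_mult[of _ n n _ n] mat_assoc)
    also have "\<dots> \<ge> 0"
      using C CT D psd_pow[OF B psd] by (intro psd_congruence(2)) auto
    finally show ?thesis .
  next
    case False
    then have "even j" using odd by simp
    then obtain r where j: "j = r + r" by (metis evenE mult_2)
    have "tr (B ^\<^sub>m i * C * B ^\<^sub>m j * transpose_mat C)
        = tr ((B ^\<^sub>m i * C * B ^\<^sub>m r) * (B ^\<^sub>m r * transpose_mat C))"
      using C CT D by (simp add: j pow_mat_add[OF Bc] mat_assoc)
    also have "\<dots> = tr ((B ^\<^sub>m r * transpose_mat C) * (B ^\<^sub>m i * C * B ^\<^sub>m r))"
      using C CT D by (intro tr_mult_comm) auto
    also have "\<dots> = tr (transpose_mat (C * B ^\<^sub>m r) * B ^\<^sub>m i * (C * B ^\<^sub>m r))"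
      using C CT D by (simp add: transpose_mult[of _ n n _ n] mat_assoc)
    also have "\<dots> \<ge> 0"
      using C CT D psd_pow[OF B psd] by (intro psd_congruence(2)) auto
    finally show ?thesis .
  qed
qed

text \<open>The bookkeeping for expanding the commutator below: under the trace, all powers of \<open>B\<close> between
  two occurrences of \<open>A\<close> merge cyclically.\<close>

lemma tr_pow_interleave_shift:
  assumes A: "A \<in> carrier_mat n n" and B: "B \<in> carrier_mat n n"
  shows "tr (B ^\<^sub>m i * (B ^\<^sub>m p * A * B ^\<^sub>m q) * B ^\<^sub>m j * (B ^\<^sub>m r * A * B ^\<^sub>m s))
       = tr (B ^\<^sub>m (s + i + p) * A * B ^\<^sub>m (q + j + r) * A)"
proof -
  have D: "B ^\<^sub>m k \<in> carrier_mat n n" for k using B by simp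
  have "tr (B ^\<^sub>m i * (B ^\<^sub>m p * A * B ^\<^sub>m q) * B ^\<^sub>m j * (B ^\<^sub>m r * A * B ^\<^sub>m s))
      = tr ((B ^\<^sub>m i * B ^\<^sub>m p * A * B ^\<^sub>m q * B ^\<^sub>m j * B ^\<^sub>m r * A) * B ^\<^sub>m s)"
    using A D by (simp add: mat_assoc)
  also have "\<dots> = tr (B ^\<^sub>m s * (B ^\<^sub>m i * B ^\<^sub>m p * A * B ^\<^sub>m q * B ^\<^sub>m j * B ^\<^sub>m r * A))"
    using A D by (intro tr_mult_comm) auto
  also have "\<dots> = tr (B ^\<^sub>m (s + i + p) * A * B ^\<^sub>m (q + j + r) * A)"
    using A D by (simp add: mat_assoc pow_mat_add[OF B])
  finally show ?thesis .
qed

text \<open>The second difference of \<open>a \<mapsto> tr (B\<^sup>a A B\<^sup>p\<^sup>-\<^sup>a A)\<close> equals \<open>tr (B\<^sup>i C B\<^sup>j C\<^sup>T)\<close> for the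
  commutator \<open>C = A B - B A\<close> and \<open>p = i + j + 2\<close>.  It is therefore nonnegative.\<close>

lemma tr_interleave_convex:
  assumes A: "A \<in> sym_mats n" and B: "B \<in> sym_mats n" and psd: "loewner_le n (0\<^sub>m n n) B"
    and odd: "odd (i + j)"
  shows "2 * tr (B ^\<^sub>m (Suc i) * A * B ^\<^sub>m (Suc j) * A)
       \<le> tr (B ^\<^sub>m i * A * B ^\<^sub>m (Suc (Suc j)) * A) + tr (B ^\<^sub>m (Suc (Suc i)) * A * B ^\<^sub>m j * A)"
proof -
  have Ac: "A \<in> carrier_mat n n" and Bc: "B \<in> carrier_mat n n" using A B by simp_all
  \<comment> \<open>The trivial powers bring both products into the form that the shift lemma expects.\<close>
  define X where "X = B ^\<^sub>m 0 * A * B ^\<^sub>m 1"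
  define Y where "Y = B ^\<^sub>m 1 * A * B ^\<^sub>m 0"
  have X: "X = A * B" and Y: "Y = B * A" using Ac Bc by (auto simp: X_def Y_def)
  have XY: "X \<in> carrier_mat n n" "Y \<in> carrier_mat n n" using Ac Bc by (auto simp: X Y)
  have T: "transpose_mat (X - Y) = Y - X"
    using A B Ac Bc
    by (simp add: X Y transpose_minus[of _ n n] transpose_mult[of _ n n _ n] sym_mats_transpose)
  have D: "B ^\<^sub>m k \<in> carrier_mat n n" for k using Bc by simp
  have "0 \<le> tr (B ^\<^sub>m i * (X - Y) * B ^\<^sub>m j * transpose_mat (X - Y))"
    using XY odd by (intro tr_sandwich_nonneg[OF B psd]) auto
  also have "\<dots> = tr (B ^\<^sub>m i * X * B ^\<^sub>m j * Y) + tr (B ^\<^sub>m i * Y * B ^\<^sub>m j * X)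
      - tr (B ^\<^sub>m i * X * B ^\<^sub>m j * X) - tr (B ^\<^sub>m i * Y * B ^\<^sub>m j * Y)"
    unfolding T using XY D
    by (simp add: mult_minus_distrib_mat[of _ n n _ n] minus_mult_distrib_mat[of _ n n _ _ n]
        tr_minus)
  also have "\<dots> = tr (B ^\<^sub>m i * A * B ^\<^sub>m (Suc (Suc j)) * A) + tr (B ^\<^sub>m (Suc (Suc i)) * A * B ^\<^sub>m j * A)
      - 2 * tr (B ^\<^sub>m (Suc i) * A * B ^\<^sub>m (Suc j) * A)"
    unfolding X_def Y_def tr_pow_interleave_shift[OF Ac Bc] by (simp del: pow_mat.simps)
  finally show ?thesis by simp
qed

text \<open>The increments of a convex sequence increase, and symmetry about \<open>p / 2\<close> makes increment
  \<open>p - 1 - i\<close> the negative of increment \<open>i\<close>.  Hence the increments in the first half are at most zero.\<close>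

lemma convex_symmetric_le_end:
  fixes h :: "nat \<Rightarrow> real"
  assumes convex: "\<And>i. i + 2 \<le> p \<Longrightarrow> 2 * h (Suc i) \<le> h i + h (Suc (Suc i))"
    and sym: "\<And>i. i \<le> p \<Longrightarrow> h (p - i) = h i"
    and "a \<le> p"
  shows "h a \<le> h 0"
proof -
  define d where "d i = h (Suc i) - h i" for i
  have d_mono: "d i \<le> d j" if "i \<le> j" "j < p" for i j
    using that
  proof (induction j)
    case (Suc j)
    show ?case
    proof (cases "i \<le> j")
      case True
      then show ?thesis using Suc convex[of j] by (simp add: d_def)
    qed (use Suc in \<open>simp add: le_Suc_eq\<close>)
  qed simp
  have d_anti: "d (p - 1 - i) = - d i" if "i < p" for i
  proof -
    have "Suc (p - 1 - i) = p - i" "p - 1 - i = p - Suc i" using that by auto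
    then show ?thesis using sym[of i] sym[of "Suc i"] that by (simp add: d_def)
  qed
  have half: "h b \<le> h 0" if "2 * b \<le> p + 1" for b
    using that
  proof (induction b)
    case (Suc b)
    have "d b \<le> d (p - 1 - b)" using Suc by (intro d_mono) auto
    also have "\<dots> = - d b" using Suc by (intro d_anti) auto
    finally show ?case using Suc by (simp add: d_def)
  qed simp
  show ?thesis
  proof (cases "2 * a \<le> p + 1")
    case False
    then show ?thesis using half[of "p - a"] sym[OF \<open>a \<le> p\<close>] by simp
  qed (rule half)
qed

text \<open>In an eigenbasis of \<open>B\<close> this is the inequality
  \<open>\<lambda>\<^sup>a \<mu>\<^sup>b + \<mu>\<^sup>a \<lambda>\<^sup>b \<le> \<lambda>\<^sup>a\<^sup>+\<^sup>b + \<mu>\<^sup>a\<^sup>+\<^sup>b\<close> for eigenvalues \<open>\<lambda>, \<mu> \<ge> 0\<close>.  With \<open>a + b\<close> fixed,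
  the left-hand side is a convex symmetric sequence in \<open>a\<close>, and the right-hand side is
  its value at \<open>a = 0\<close>.\<close>

lemma tr_interleave_le:
  assumes A: "A \<in> sym_mats n" and B: "B \<in> sym_mats n" and psd: "loewner_le n (0\<^sub>m n n) B"
    and odd: "odd (a + b)"
  shows "tr (A * B ^\<^sub>m a * A * B ^\<^sub>m b) \<le> tr (A * B ^\<^sub>m (a + b) * A)"
proof -
  have Ac: "A \<in> carrier_mat n n" and Bc: "B \<in> carrier_mat n n" using A B by simp_all
  have D: "B ^\<^sub>m k \<in> carrier_mat n n" for k using Bc by simp
  define p where "p = a + b"
  define h where "h i = tr (B ^\<^sub>m i * A * B ^\<^sub>m (p - i) * A)" for i
  have h_eq: "h i = tr (A * B ^\<^sub>m i * A * B ^\<^sub>m (p - i))" for i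
  proof -
    have "h i = tr ((B ^\<^sub>m i * A * B ^\<^sub>m (p - i)) * A)" by (simp add: h_def)
    also have "\<dots> = tr (A * (B ^\<^sub>m i * A * B ^\<^sub>m (p - i)))"
      using Ac D by (intro tr_mult_comm) auto
    also have "\<dots> = tr (A * B ^\<^sub>m i * A * B ^\<^sub>m (p - i))"
      using Ac D by (simp add: mat_assoc)
    finally show ?thesis .
  qed
  have "h a \<le> h 0"
  proof (rule convex_symmetric_le_end[of p])
    fix i assume i: "i + 2 \<le> p"
    define j where "j = p - i - 2"
    have j: "p - i = Suc (Suc j)" "p - Suc i = Suc j" "p - Suc (Suc i) = j" "odd (i + j)"
      using i odd by (auto simp: j_def p_def)
    show "2 * h (Suc i) \<le> h i + h (Suc (Suc i))"
      unfolding h_def j using tr_interleave_convex[OF A B psd j(4)] .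
  next
    fix i assume i: "i \<le> p"
    have "h (p - i) = tr ((B ^\<^sub>m (p - i) * A) * (B ^\<^sub>m i * A))"
      using i Ac D by (simp add: h_def mat_assoc)
    also have "\<dots> = tr ((B ^\<^sub>m i * A) * (B ^\<^sub>m (p - i) * A))"
      using Ac D by (intro tr_mult_comm) auto
    also have "\<dots> = h i"
      using Ac D by (simp add: h_def mat_assoc)
    finally show "h (p - i) = h i" .
  qed (simp add: p_def)
  also have "h 0 = tr (A * B ^\<^sub>m (a + b) * A)"
    using Ac Bc D by (simp add: h_def p_def)
  finally show ?thesis using h_eq[of a] by (simp add: p_def)
qed

section \<open>Powers along a segment of matrices\<close>

text \<open>The weight \<open>W\<close> makes the induction on the exponent close: rotating one factor \<open>B - s C\<close> of the
  power to the front leaves traces with one power less and the weights \<open>B W\<close> and \<open>C W\<close>, which no longer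
  depend on \<open>s\<close>.\<close>

lemma has_derivative_tr_pow:
  assumes W: "W \<in> carrier_mat n n" and B: "B \<in> carrier_mat n n" and C: "C \<in> carrier_mat n n"
  shows "((\<lambda>s. tr (W * (B - s \<cdot>\<^sub>m C) ^\<^sub>m k)) has_real_derivative
           - (\<Sum>a<k. tr (W * (B - s \<cdot>\<^sub>m C) ^\<^sub>m a * C * (B - s \<cdot>\<^sub>m C) ^\<^sub>m (k - 1 - a)))) (at s)"
  using W
proof (induction k arbitrary: W)
  case 0
  show ?case using 0 B C by simp
next
  case (Suc k)
  define M where "M s = B - s \<cdot>\<^sub>m C" for s
  have M: "M s \<in> carrier_mat n n" "M s ^\<^sub>m j \<in> carrier_mat n n" for s j
    using B C by (auto simp: M_def)
  have W: "W \<in> carrier_mat n n" using Suc by simp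
  have peel: "tr (W * M s ^\<^sub>m (Suc k)) = tr ((B * W) * M s ^\<^sub>m k) - s * tr ((C * W) * M s ^\<^sub>m k)" for s
  proof -
    have "tr (W * M s ^\<^sub>m (Suc k)) = tr ((W * M s ^\<^sub>m k) * M s)"
      using W M by (simp add: mat_assoc)
    also have "\<dots> = tr (M s * (W * M s ^\<^sub>m k))"
      using W M by (intro tr_mult_comm) auto
    also have "\<dots> = tr (B * (W * M s ^\<^sub>m k) - s \<cdot>\<^sub>m (C * (W * M s ^\<^sub>m k)))"
      using W M B C unfolding M_def[of s]
      by (subst minus_mult_distrib_mat[of _ n n]) auto
    also have "\<dots> = tr ((B * W) * M s ^\<^sub>m k) - s * tr ((C * W) * M s ^\<^sub>m k)"
      using W M B C by (simp add: tr_minus tr_smult mat_assoc)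
    finally show ?thesis .
  qed
  define S where "S V = (\<Sum>a<k. tr (V * M s ^\<^sub>m a * C * M s ^\<^sub>m (k - 1 - a)))" for V
  have d: "((\<lambda>s. tr (V * M s ^\<^sub>m k)) has_real_derivative - S V) (at s)"
    if "V \<in> carrier_mat n n" for V
    using Suc.IH[OF that] by (simp add: M_def S_def)
  have "((\<lambda>s. tr (W * M s ^\<^sub>m (Suc k))) has_real_derivative
      - S (B * W) - (1 * tr ((C * W) * M s ^\<^sub>m k) + s * - S (C * W))) (at s)"
    unfolding peel using B C W
    by (auto intro!: derivative_eq_intros d)
  also have "- S (B * W) - (1 * tr ((C * W) * M s ^\<^sub>m k) + s * - S (C * W))
      = - (\<Sum>a<Suc k. tr (W * M s ^\<^sub>m a * C * M s ^\<^sub>m (Suc k - 1 - a)))"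
  proof -
    have "S (B * W) - s * S (C * W) = (\<Sum>a<k. tr (W * M s ^\<^sub>m a * C * M s ^\<^sub>m (k - a)))"
      unfolding S_def sum_distrib_left sum_subtractf[symmetric]
    proof (intro sum.cong refl)
      fix a assume a: "a \<in> {..<k}"
      define V where "V = W * M s ^\<^sub>m a * C * M s ^\<^sub>m (k - 1 - a)"
      have V: "V \<in> carrier_mat n n" using W C M by (simp add: V_def)
      have "tr (B * W * M s ^\<^sub>m a * C * M s ^\<^sub>m (k - 1 - a))
            - s * tr (C * W * M s ^\<^sub>m a * C * M s ^\<^sub>m (k - 1 - a))
          = tr (B * V) - s * tr (C * V)"
        using W C M B by (simp add: V_def mat_assoc)
      also have "\<dots> = tr (B * V - s \<cdot>\<^sub>m (C * V))"
        using V B C by (simp add: tr_minus tr_smult)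
      also have "\<dots> = tr (M s * V)"
        using V B C unfolding M_def by (subst minus_mult_distrib_mat[of _ n n]) auto
      also have "\<dots> = tr (V * M s)"
        using V M by (intro tr_mult_comm) auto
      also have "\<dots> = tr (W * M s ^\<^sub>m a * C * (M s ^\<^sub>m (Suc (k - 1 - a))))"
        using W C M by (simp add: V_def mat_assoc)
      also have "Suc (k - 1 - a) = k - a" using a by auto
      finally show "tr (B * W * M s ^\<^sub>m a * C * M s ^\<^sub>m (k - 1 - a))
            - s * tr (C * W * M s ^\<^sub>m a * C * M s ^\<^sub>m (k - 1 - a))
          = tr (W * M s ^\<^sub>m a * C * M s ^\<^sub>m (k - a))" .
    qed
    moreover have "tr ((C * W) * M s ^\<^sub>m k) = tr (W * M s ^\<^sub>m k * C * M s ^\<^sub>m 0)"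
    proof -
      have "tr (C * (W * M s ^\<^sub>m k)) = tr ((W * M s ^\<^sub>m k) * C)"
        using W C M by (intro tr_mult_comm) auto
      moreover have "M s ^\<^sub>m 0 = 1\<^sub>m n" using M(1)[of s] by auto
      ultimately show ?thesis using W C M by (simp add: mat_assoc)
    qed
    ultimately show ?thesis by simp
  qed
  finally show ?case unfolding M_def .
qed

text \<open>Expand \<open>0 \<le> \<bar>B v - \<beta> v\<bar>\<^sup>2\<close> and use \<open>\<beta> \<bar>v\<bar>\<^sup>2 \<le> \<langle>v, B v\<rangle>\<close>.\<close>

lemma scaled_le_square:
  assumes B: "B \<in> sym_mats n" and \<beta>: "0 < \<beta>" and le: "loewner_le n (\<beta> \<cdot>\<^sub>m 1\<^sub>m n) B"
  shows "loewner_le n (\<beta> \<cdot>\<^sub>m B) (B * B)"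
  unfolding loewner_le_def
proof
  fix v :: "real vec" assume v: "v \<in> carrier_vec n"
  have Bc: "B \<in> carrier_mat n n" using B by simp
  define w where "w = B *\<^sub>v v"
  have w: "w \<in> carrier_vec n" using Bc v by (simp add: w_def)
  have "0 \<le> (w - \<beta> \<cdot>\<^sub>v v) \<bullet> (w - \<beta> \<cdot>\<^sub>v v)"
    by (auto simp: scalar_prod_def intro!: sum_nonneg)
  also have "\<dots> = w \<bullet> w - 2 * \<beta> * (v \<bullet> w) + \<beta> * (\<beta> * (v \<bullet> v))"
    using v w comm_scalar_prod[OF w v]
    by (simp add: minus_scalar_prod_distrib[of _ n] scalar_prod_minus_distrib[of _ n] algebra_simps)
  also have "\<dots> \<le> w \<bullet> w - 2 * \<beta> * (v \<bullet> w) + \<beta> * (v \<bullet> w)"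
    using le v \<beta> unfolding loewner_le_def by (intro add_left_mono mult_left_mono) (auto simp: w_def)
  finally have "\<beta> * (v \<bullet> w) \<le> w \<bullet> w" by (simp add: algebra_simps)
  moreover have "v \<bullet> ((B * B) *\<^sub>v v) = w \<bullet> w"
    using quad_transpose[of B v w] B Bc v w by (simp add: w_def sym_mats_transpose assoc_mult_mat_vec[of B n n B n v])
  ultimately show "v \<bullet> ((\<beta> \<cdot>\<^sub>m B) *\<^sub>v v) \<le> v \<bullet> ((B * B) *\<^sub>v v)"
    using Bc v by (simp add: w_def)
qed

text \<open>An even power is a square, so the trace is that of a congruence of \<open>P\<close> by \<open>B\<^sup>m\<close>.\<close>

lemma tr_even_pow_mono:
  assumes B: "B \<in> sym_mats n" and P: "P \<in> carrier_mat n n" and Q: "Q \<in> carrier_mat n n"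
    and le: "loewner_le n P Q"
  shows "tr (P * B ^\<^sub>m (2 * m)) \<le> tr (Q * B ^\<^sub>m (2 * m))"
proof -
  have Bc: "B \<in> carrier_mat n n" using B by simp
  have D: "B ^\<^sub>m m \<in> carrier_mat n n" "transpose_mat (B ^\<^sub>m m) = B ^\<^sub>m m"
    using sym_mats_pow[OF B, of m] by (simp_all add: sym_mats_transpose)
  have eq: "tr (P * B ^\<^sub>m (2 * m)) = tr (transpose_mat (B ^\<^sub>m m) * P * B ^\<^sub>m m)"
    if "P \<in> carrier_mat n n" for P
  proof -
    have "tr (P * B ^\<^sub>m (2 * m)) = tr ((P * B ^\<^sub>m m) * B ^\<^sub>m m)"
      using that D by (simp add: mult_2 pow_mat_add[OF Bc] mat_assoc)
    also have "\<dots> = tr (B ^\<^sub>m m * (P * B ^\<^sub>m m))"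
      using that D by (intro tr_mult_comm) auto
    finally show ?thesis using that D by (simp add: mat_assoc)
  qed
  show ?thesis
    unfolding eq[OF P] eq[OF Q] by (rule tr_congruence_mono[OF D(1) P Q le])
qed

text \<open>The effect of one summand on the potential.  Write \<open>B s = B0 - s C\<close> and
  \<open>g(s) = tr (C (B s)\<^sup>2\<^sup>m)\<close>, so that the trace of \<open>(B s)\<^sup>K\<close> has derivative \<open>- K g(s)\<close> for \<open>K = 2 m + 1\<close>.  Every one of
  the \<open>2 m\<close> terms of \<open>- g'(s)\<close> is at most
  \<open>tr (C (B s)\<^sup>2\<^sup>m\<^sup>-\<^sup>1 C) \<le> tr (C (B s)\<^sup>2\<^sup>m C) / \<beta> \<le> (r / \<beta>) g(s)\<close>.  Hence \<open>g(s) \<ge> g(0) exp (- \<kappa> s)\<close> with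
  \<open>\<kappa> = K r / \<beta>\<close>, and integrating over \<open>[0, 1]\<close> gives the claim.\<close>

lemma tr_pow_minus_le:
  assumes B0: "B0 \<in> sym_mats n" and C: "C \<in> sym_mats n"
    and C_psd: "loewner_le n (0\<^sub>m n n) C" and C_le: "loewner_le n C (r \<cdot>\<^sub>m 1\<^sub>m n)" and r: "0 < r"
    and \<beta>: "0 < \<beta>" "\<beta> \<le> 1" and lower: "loewner_le n (\<beta> \<cdot>\<^sub>m 1\<^sub>m n) (B0 - C)"
    and m: "1 \<le> m"
  shows "tr ((B0 - C) ^\<^sub>m (2 * m + 1))
       \<le> tr (B0 ^\<^sub>m (2 * m + 1)) - \<beta> / r * (1 - exp (- (real (2 * m + 1) * r))) * tr (C * B0 ^\<^sub>m (2 * m))"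
proof -
  define B where "B s = B0 - s \<cdot>\<^sub>m C" for s
  have Cc: "C \<in> carrier_mat n n" and B0c: "B0 \<in> carrier_mat n n" using C B0 by simp_all
  have B: "B s \<in> sym_mats n" for s using B0 C by (simp add: B_def)
  have Bc: "B s \<in> carrier_mat n n" "B s ^\<^sub>m k \<in> carrier_mat n n" for s k using B[of s] by simp_all
  have ends: "B 0 = B0" "B 1 = B0 - C" using B0c Cc by (auto simp: B_def)
  have B_lower: "loewner_le n (\<beta> \<cdot>\<^sub>m 1\<^sub>m n) (B s)" if "s \<le> 1" for s
    unfolding loewner_le_def
  proof
    fix v :: "real vec" assume v: "v \<in> carrier_vec n"
    define q where "q = v \<bullet> (C *\<^sub>v v)"
    have "0 \<le> q" using C_psd v by (simp add: psd_iff q_def)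
    then have "s * q \<le> q" using that mult_right_mono[of s 1 q] by simp
    moreover have "v \<bullet> (B s *\<^sub>v v) = v \<bullet> (B0 *\<^sub>v v) - s * q"
      using v Cc B0c by (simp add: B_def q_def scalar_prod_minus_distrib[of _ n])
    moreover have "v \<bullet> ((B0 - C) *\<^sub>v v) = v \<bullet> (B0 *\<^sub>v v) - q"
      using v Cc B0c by (simp add: q_def scalar_prod_minus_distrib[of _ n])
    moreover have "v \<bullet> ((\<beta> \<cdot>\<^sub>m 1\<^sub>m n) *\<^sub>v v) \<le> v \<bullet> ((B0 - C) *\<^sub>v v)"
      using lower v by (simp add: loewner_le_def)
    ultimately show "v \<bullet> ((\<beta> \<cdot>\<^sub>m 1\<^sub>m n) *\<^sub>v v) \<le> v \<bullet> (B s *\<^sub>v v)" by simp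
  qed
  have B_psd: "loewner_le n (0\<^sub>m n n) (B s)" if "s \<le> 1" for s
    unfolding psd_iff
  proof
    fix v :: "real vec" assume v: "v \<in> carrier_vec n"
    have "0 \<le> \<beta> * (v \<bullet> v)" using \<beta> by (simp add: scalar_prod_def sum_nonneg)
    also have "\<dots> \<le> v \<bullet> (B s *\<^sub>v v)"
      using B_lower[OF that] v by (force simp: loewner_le_def)
    finally show "0 \<le> v \<bullet> (B s *\<^sub>v v)" .
  qed
  define g where "g s = tr (C * B s ^\<^sub>m (2 * m))" for s
  define g' where "g' s = - (\<Sum>a<2 * m. tr (C * B s ^\<^sub>m a * C * B s ^\<^sub>m (2 * m - 1 - a)))" for s
  define K where "K = 2 * m + 1"
  define \<kappa> where "\<kappa> = real K * r / \<beta>"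
  have \<kappa>: "0 < \<kappa>" using r \<beta> by (simp add: \<kappa>_def K_def)
  have g_deriv: "(g has_real_derivative g' s) (at s)" for s
    unfolding g_def[abs_def] g'_def B_def
    by (rule has_derivative_tr_pow) (use Cc B0c in auto)
  have \<phi>_deriv: "((\<lambda>s. tr (B s ^\<^sub>m K)) has_real_derivative - real K * g s) (at s)" for s
  proof -
    have "((\<lambda>s. tr (1\<^sub>m n * B s ^\<^sub>m K)) has_real_derivative
        - (\<Sum>a<K. tr (1\<^sub>m n * B s ^\<^sub>m a * C * B s ^\<^sub>m (K - 1 - a)))) (at s)"
      unfolding B_def by (rule has_derivative_tr_pow) (use Cc B0c in auto)
    moreover have "tr (1\<^sub>m n * B s ^\<^sub>m a * C * B s ^\<^sub>m (K - 1 - a)) = g s" if "a < K" for a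
    proof -
      have "tr (1\<^sub>m n * B s ^\<^sub>m a * C * B s ^\<^sub>m (K - 1 - a)) = tr (B s ^\<^sub>m a * (C * B s ^\<^sub>m (K - 1 - a)))"
        using Bc Cc by (simp add: mat_assoc)
      also have "\<dots> = tr ((C * B s ^\<^sub>m (K - 1 - a)) * B s ^\<^sub>m a)"
        using Bc Cc by (intro tr_mult_comm) auto
      also have "\<dots> = tr (C * B s ^\<^sub>m ((K - 1 - a) + a))"
        using Bc Cc by (simp add: mat_assoc pow_mat_add[OF Bc(1)])
      also have "(K - 1 - a) + a = 2 * m" using that by (simp add: K_def)
      finally show ?thesis by (simp add: g_def)
    qed
    moreover have "1\<^sub>m n * B s ^\<^sub>m K = B s ^\<^sub>m K" for s using Bc by simp
    ultimately show ?thesis by simp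
  qed
  have g_nonneg: "0 \<le> g s" for s
    using tr_even_pow_mono[OF B[of s] zero_carrier_mat Cc C_psd, of m] Bc[of s]
    by (simp add: g_def left_mult_zero_mat[of _ n n] tr_def)
  have g'_ge: "- \<kappa> * g s \<le> g' s" if s: "s \<le> 1" for s
  proof -
    define D where "D = B s ^\<^sub>m (m - 1)"
    have D: "D \<in> carrier_mat n n" "transpose_mat D = D"
      using sym_mats_pow[OF B[of s], of "m - 1"] by (simp_all add: D_def sym_mats_transpose)
    have odd: "loewner_le n (\<beta> \<cdot>\<^sub>m B s ^\<^sub>m (2 * m - 1)) (B s ^\<^sub>m (2 * m))"
    proof -
      have "2 * m - 1 = (m - 1) + (1 + (m - 1))" "2 * m = (m - 1) + ((1 + 1) + (m - 1))"
        using m by auto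
      then have "\<beta> \<cdot>\<^sub>m B s ^\<^sub>m (2 * m - 1) = transpose_mat D * (\<beta> \<cdot>\<^sub>m B s) * D"
        and "B s ^\<^sub>m (2 * m) = transpose_mat D * (B s * B s) * D"
        using Bc[of s] D
        by (simp_all only: pow_mat_add[OF Bc(1)] D_def[symmetric] D(2))
          (auto simp: mat_assoc)
      then show ?thesis
        using loewner_congruence_mono[OF D(1) _ _ scaled_le_square[OF B \<beta>(1) B_lower[OF s]]] Bc[of s]
        by simp
    qed
    have term_le: "\<beta> * tr (C * B s ^\<^sub>m a * C * B s ^\<^sub>m (2 * m - 1 - a)) \<le> r * g s" if a: "a < 2 * m" for a
    proof -
      have "tr (C * B s ^\<^sub>m a * C * B s ^\<^sub>m (2 * m - 1 - a)) \<le> tr (C * B s ^\<^sub>m (a + (2 * m - 1 - a)) * C)"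
        using a m by (intro tr_interleave_le[OF C B B_psd[OF s]]) auto
      also have "a + (2 * m - 1 - a) = 2 * m - 1" using a by simp
      finally have "\<beta> * tr (C * B s ^\<^sub>m a * C * B s ^\<^sub>m (2 * m - 1 - a))
          \<le> \<beta> * tr (C * B s ^\<^sub>m (2 * m - 1) * C)" using \<beta> by simp
      also have "\<dots> = tr (transpose_mat C * (\<beta> \<cdot>\<^sub>m B s ^\<^sub>m (2 * m - 1)) * C)"
        using Cc Bc[of s] tr_smult[of "C * B s ^\<^sub>m (2 * m - 1) * C" \<beta>]
        by (simp add: sym_mats_transpose[OF C])
      also have "\<dots> \<le> tr (transpose_mat C * B s ^\<^sub>m (2 * m) * C)"
        using Cc Bc[of s] by (intro tr_congruence_mono[OF _ _ _ odd]) auto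
      also have "\<dots> = tr ((C * C) * B s ^\<^sub>m (2 * m))"
        using Cc Bc[of s] tr_mult_comm[of "C * B s ^\<^sub>m (2 * m)" C]
        by (simp add: sym_mats_transpose[OF C] mat_assoc)
      also have "\<dots> \<le> tr ((r \<cdot>\<^sub>m C) * B s ^\<^sub>m (2 * m))"
        using Cc by (intro tr_even_pow_mono[OF B] loewner_square_le[OF C C_psd C_le]) auto
      also have "\<dots> = r * g s"
        using Cc Bc[of s] tr_smult[of "C * B s ^\<^sub>m (2 * m)" r]
        by (simp add: g_def)
      finally show ?thesis .
    qed
    have "- (\<beta> * g' s) = (\<Sum>a<2 * m. \<beta> * tr (C * B s ^\<^sub>m a * C * B s ^\<^sub>m (2 * m - 1 - a)))"
      by (simp add: g'_def sum_distrib_left)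
    also have "\<dots> \<le> (\<Sum>a<2 * m. r * g s)" by (intro sum_mono term_le) simp
    also have "\<dots> \<le> real K * (r * g s)"
      using r g_nonneg[of s] by (simp add: K_def algebra_simps)
    finally show ?thesis using \<beta> by (simp add: \<kappa>_def field_simps)
  qed
  have g_ge: "g 0 * exp (- \<kappa> * s) \<le> g s" if s: "0 \<le> s" "s \<le> 1" for s
  proof -
    have "g 0 * exp (\<kappa> * 0) \<le> g s * exp (\<kappa> * s)"
    proof (rule DERIV_nonneg_imp_nondecreasing[OF s(1)])
      fix t assume t: "0 \<le> t" "t \<le> s"
      have "((\<lambda>t. g t * exp (\<kappa> * t)) has_real_derivative (g' t + \<kappa> * g t) * exp (\<kappa> * t)) (at t)"
        by (auto intro!: derivative_eq_intros g_deriv simp: algebra_simps)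
      moreover have "0 \<le> (g' t + \<kappa> * g t) * exp (\<kappa> * t)"
        using g'_ge[of t] t s by simp
      ultimately show "\<exists>y. ((\<lambda>t. g t * exp (\<kappa> * t)) has_real_derivative y) (at t) \<and> 0 \<le> y" by blast
    qed
    then show ?thesis by (simp add: exp_minus field_simps)
  qed
  \<comment> \<open>Integration of the lower bound for \<open>g\<close>, stated as monotonicity of the trace plus the antiderivative of \<open>K g(0) exp (- \<kappa> t)\<close>.\<close>
  have "tr (B 1 ^\<^sub>m K) + real K * g 0 * (1 - exp (- \<kappa> * 1)) / \<kappa>
      \<le> tr (B 0 ^\<^sub>m K) + real K * g 0 * (1 - exp (- \<kappa> * 0)) / \<kappa>"
  proof (rule DERIV_nonpos_imp_nonincreasing[of 0 1])
    fix t :: real assume t: "0 \<le> t" "t \<le> 1"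
    have "((\<lambda>t. tr (B t ^\<^sub>m K) + real K * g 0 * (1 - exp (- \<kappa> * t)) / \<kappa>) has_real_derivative
        - real K * g t + real K * g 0 * exp (- \<kappa> * t)) (at t)"
      using \<kappa> by (auto intro!: derivative_eq_intros \<phi>_deriv)
    moreover have "- real K * g t + real K * g 0 * exp (- \<kappa> * t) \<le> 0"
      using g_ge[OF t] mult_left_mono[of "g 0 * exp (- \<kappa> * t)" "g t" "real K"] by simp
    ultimately show "\<exists>y. ((\<lambda>t. tr (B t ^\<^sub>m K) + real K * g 0 * (1 - exp (- \<kappa> * t)) / \<kappa>)
        has_real_derivative y) (at t) \<and> y \<le> 0" by blast
  qed simp
  also have "real K / \<kappa> = \<beta> / r" using r \<beta> by (simp add: \<kappa>_def K_def)
  then have "real K * g 0 * (1 - exp (- \<kappa> * 1)) / \<kappa> = \<beta> / r * (1 - exp (- \<kappa>)) * g 0"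
    by (metis (no_types, lifting) mult.commute mult.left_commute mult_1_right mult_minus_left times_divide_eq_right)
  finally have "tr (B 1 ^\<^sub>m K) \<le> tr (B 0 ^\<^sub>m K) - \<beta> / r * (1 - exp (- \<kappa>)) * g 0" by simp
  also have "\<beta> / r * (1 - exp (- (real K * r))) * g 0 \<le> \<beta> / r * (1 - exp (- \<kappa>)) * g 0"
  proof -
    have "real K * r \<le> \<kappa>"
      using r \<beta> mult_left_mono[of \<beta> 1 "real K * r"] by (simp add: \<kappa>_def pos_le_divide_eq)
    then show ?thesis
      using r \<beta> g_nonneg[of 0] by (intro mult_right_mono mult_left_mono) auto
  qed
  then have "tr (B 0 ^\<^sub>m K) - \<beta> / r * (1 - exp (- \<kappa>)) * g 0
      \<le> tr (B 0 ^\<^sub>m K) - \<beta> / r * (1 - exp (- (real K * r))) * g 0" by simp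
  finally show ?thesis by (simp only: ends K_def g_def)
qed

end

section \<open>The smallest eigenvalue of a real symmetric matrix\<close>

text \<open>A complex eigenvalue \<open>e\<close> exists because the characteristic polynomial has a root; for an
  eigenvector \<open>v\<close>, moving the matrix across the Hermitian product gives \<open>e \<bar>v\<bar>\<^sup>2 = cnj e \<bar>v\<bar>\<^sup>2\<close>, so \<open>e\<close> is real and
  a root of the real characteristic polynomial.\<close>

lemma symmetric_spectrum_nonempty:
  fixes A :: "real mat"
  assumes A: "A \<in> sym_mats n" and n: "0 < n"
  shows "spectrum A \<noteq> {}"
proof -
  have Ac: "A \<in> carrier_mat n n" using A by (rule sym_mats_carrier)
  define Z where "Z = map_mat complex_of_real A"
  have Z: "Z \<in> carrier_mat n n" using Ac by (simp add: Z_def)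
  obtain e v where v: "v \<in> carrier_vec n" "v \<noteq> 0\<^sub>v n" and Zv: "Z *\<^sub>v v = e \<cdot>\<^sub>v v"
    using spectrum_non_empty[OF Z n] Z
    by (auto simp: spectrum_def eigenvalue_def eigenvector_def)
  have cv: "conjugate v \<in> carrier_vec n" using v by simp
  have ZT: "transpose_mat Z = Z"
    unfolding Z_def map_mat_transpose sym_mats_transpose[OF A] ..
  have Zc: "Z *\<^sub>v conjugate v = conjugate (Z *\<^sub>v v)"
    using Ac v by (intro eq_vecI) (auto simp: Z_def scalar_prod_def)
  have "e * (v \<bullet> conjugate v) = (Z *\<^sub>v v) \<bullet> conjugate v"
    using v cv by (simp add: Zv)
  also have "\<dots> = v \<bullet> (Z *\<^sub>v conjugate v)"
    using transpose_vec_mult_scalar[OF Z cv v(1)] comm_scalar_prod[of "Z *\<^sub>v v" n "conjugate v"]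
      transpose_vec_mult_scalar[OF Z v(1) cv] comm_scalar_prod[of v n "Z *\<^sub>v conjugate v"] v cv Z
    by (simp add: ZT)
  also have "\<dots> = cnj e * (v \<bullet> conjugate v)"
    using v cv by (simp add: Zc Zv conjugate_smult_vec)
  finally have "e = cnj e"
    using v by simp
  then have e: "e = complex_of_real (Re e)"
    by (simp add: complex_eq_iff)
  have "eigenvalue Z e"
    using v Zv Z by (auto simp: eigenvalue_def eigenvector_def)
  then have "poly (map_poly complex_of_real (char_poly A)) (complex_of_real (Re e)) = 0"
    unfolding eigenvalue_root_char_poly[OF Z] using of_real_hom.char_poly_hom[OF Ac] e
    by (metis Z_def)
  then have "poly (char_poly A) (Re e) = 0"
    by simp
  then show ?thesis
    using spectrum_root_char_poly[OF Ac] by auto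
qed

text \<open>Needed because \<open>lambda_min\<close> is a minimum over the real spectrum, which says nothing for an empty
  spectrum.\<close>

lemma lambda_min_eigenvector:
  assumes A: "A \<in> sym_mats n" and n: "0 < n"
  obtains v where "v \<in> carrier_vec n" "v \<noteq> 0\<^sub>v n" "A *\<^sub>v v = lambda_min A \<cdot>\<^sub>v v"
proof -
  have "lambda_min A \<in> spectrum A"
    unfolding lambda_min_def
    using card_finite_spectrum[OF sym_mats_carrier[OF A]] symmetric_spectrum_nonempty[OF A n]
    by (intro Min_in)
  then show thesis
    using that A sym_mats_carrier[OF A] by (auto simp: spectrum_def eigenvalue_def eigenvector_def)
qed

text \<open>The trace of \<open>D\<^sup>2\<close> is the squared Frobenius norm, which bounds the squared operator norm by the
  Cauchy--Schwarz inequality for every row.\<close>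

lemma tr_square_sym_ge:
  assumes D: "D \<in> sym_mats n" and v: "v \<in> carrier_vec n" and Dv: "D *\<^sub>v v = \<mu> \<cdot>\<^sub>v v" and v0: "v \<noteq> 0\<^sub>v n"
  shows "\<mu>\<^sup>2 \<le> tr (D * D)"
proof -
  have Dc: "D \<in> carrier_mat n n" using D by (rule sym_mats_carrier)
  have vv: "0 < v \<bullet> v"
    using conjugate_square_greater_0_vec[OF v] v0 by simp
  have one: "1\<^sub>m n \<in> sym_mats n" "loewner_le n (0\<^sub>m n n) (1\<^sub>m n)"
    by (auto intro!: sym_matsI sum_nonneg simp: psd_iff scalar_prod_def)
  have row: "row D i \<bullet> row D i = row D i \<bullet> col D i" if "i < n" for i
    using that D Dc by (metis carrier_matD(1) col_transpose sym_mats_transpose)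
  have "\<mu>\<^sup>2 * (v \<bullet> v) = (\<Sum>i<n. (row D i \<bullet> v)\<^sup>2)"
  proof -
    have "\<mu>\<^sup>2 * (v \<bullet> v) = (\<mu> \<cdot>\<^sub>v v) \<bullet> (\<mu> \<cdot>\<^sub>v v)"
      using v by (simp add: power2_eq_square)
    also have "\<dots> = (\<Sum>i<n. (row D i \<bullet> v)\<^sup>2)"
      unfolding Dv[symmetric] scalar_prod_def[of "D *\<^sub>v v" "D *\<^sub>v v"] using Dc v
      by (simp add: power2_eq_square atLeast0LessThan)
    finally show ?thesis .
  qed
  also have "\<dots> \<le> (\<Sum>i<n. (row D i \<bullet> row D i) * (v \<bullet> v))"
  proof (intro sum_mono)
    fix i assume "i \<in> {..<n}"
    then have "row D i \<in> carrier_vec n" using Dc by simp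
    then show "(row D i \<bullet> v)\<^sup>2 \<le> (row D i \<bullet> row D i) * (v \<bullet> v)"
      using psd_Cauchy_Schwarz[OF one, of "row D i" v] v by simp
  qed
  also have "\<dots> = tr (D * D) * (v \<bullet> v)"
    using Dc row by (simp add: tr_def sum_distrib_right)
  finally show ?thesis using vv by simp
qed

text \<open>The factor \<open>\<beta>\<close> is the price for working with the even power \<open>2 m\<close>: one factor \<open>B\<close> is estimated
  from below by \<open>\<beta>\<close>.\<close>

lemma tr_odd_pow_ge_eigenvalue:
  assumes B: "B \<in> sym_mats n" and le: "loewner_le n (\<beta> \<cdot>\<^sub>m 1\<^sub>m n) B" and \<beta>: "0 \<le> \<beta>"
    and v: "v \<in> carrier_vec n" "v \<noteq> 0\<^sub>v n" and Bv: "B *\<^sub>v v = \<mu> \<cdot>\<^sub>v v"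
  shows "\<beta> * \<mu> ^ (2 * m) \<le> tr (B ^\<^sub>m (2 * m + 1))"
proof -
  have Bc: "B \<in> carrier_mat n n" using B by (rule sym_mats_carrier)
  have D: "B ^\<^sub>m m \<in> sym_mats n" "B ^\<^sub>m (2 * m) \<in> carrier_mat n n" using B Bc by simp_all
  have ev: "eigenvector B v \<mu>" using v Bv Bc by (simp add: eigenvector_def)
  have "\<beta> * \<mu> ^ (2 * m) = \<beta> * (\<mu> ^ m)\<^sup>2"
    by (simp add: power_mult[symmetric] mult.commute)
  also have "\<dots> \<le> \<beta> * tr (B ^\<^sub>m m * B ^\<^sub>m m)"
    using tr_square_sym_ge[OF D(1) v(1) eigenvector_pow[OF Bc ev] v(2)] \<beta> by (rule mult_left_mono)
  also have "\<dots> = tr ((\<beta> \<cdot>\<^sub>m 1\<^sub>m n) * B ^\<^sub>m (2 * m))"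
    using D tr_smult[of "B ^\<^sub>m (2 * m)" n \<beta>]
    by (simp add: mult_2 pow_mat_add[OF Bc] smult_mult_mat[of _ n] one_mult_mat[of _ n])
  also have "\<dots> \<le> tr (B * B ^\<^sub>m (2 * m))"
    using Bc by (intro tr_even_pow_mono[OF B] le) auto
  also have "\<dots> = tr (B ^\<^sub>m (2 * m + 1))"
    using pow_mat_commute[OF Bc, of "2 * m"] by simp
  finally show ?thesis .
qed

section \<open>Bounded random matrices\<close>

definition bounded_measurable :: "'a measure \<Rightarrow> ('a \<Rightarrow> real) \<Rightarrow> bool" where
  "bounded_measurable Q f \<longleftrightarrow> f \<in> borel_measurable Q \<and> (\<exists>b. \<forall>x\<in>space Q. \<bar>f x\<bar> \<le> b)"

definition bounded_mat_fun :: "'a measure \<Rightarrow> nat \<Rightarrow> ('a \<Rightarrow> real mat) \<Rightarrow> bool" where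
  "bounded_mat_fun Q n F \<longleftrightarrow> (\<forall>x\<in>space Q. F x \<in> carrier_mat n n) \<and>
     (\<forall>i<n. \<forall>j<n. bounded_measurable Q (\<lambda>x. F x $$ (i, j)))"

lemma bounded_measurable_cong:
  "(\<And>x. x \<in> space Q \<Longrightarrow> f x = g x) \<Longrightarrow> bounded_measurable Q f \<longleftrightarrow> bounded_measurable Q g"
  unfolding bounded_measurable_def by (metis measurable_cong)

lemma bounded_measurable_const [simp]: "bounded_measurable Q (\<lambda>_. c)"
  by (auto simp: bounded_measurable_def)

lemma bounded_measurable_add:
  "bounded_measurable Q f \<Longrightarrow> bounded_measurable Q g \<Longrightarrow> bounded_measurable Q (\<lambda>x. f x + g x)"
  unfolding bounded_measurable_def
proof safe
  fix a b assume "\<forall>x\<in>space Q. \<bar>f x\<bar> \<le> a" "\<forall>x\<in>space Q. \<bar>g x\<bar> \<le> b"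
  then have "\<forall>x\<in>space Q. \<bar>f x + g x\<bar> \<le> a + b" by (meson abs_triangle_ineq add_mono order_trans)
  then show "\<exists>b. \<forall>x\<in>space Q. \<bar>f x + g x\<bar> \<le> b" by blast
qed simp

lemma bounded_measurable_mult:
  "bounded_measurable Q f \<Longrightarrow> bounded_measurable Q g \<Longrightarrow> bounded_measurable Q (\<lambda>x. f x * g x)"
  unfolding bounded_measurable_def
proof safe
  fix a b assume ab: "\<forall>x\<in>space Q. \<bar>f x\<bar> \<le> a" "\<forall>x\<in>space Q. \<bar>g x\<bar> \<le> b"
  have "\<bar>f x * g x\<bar> \<le> a * b" if "x \<in> space Q" for x
  proof -
    have "\<bar>f x\<bar> \<le> a" "\<bar>g x\<bar> \<le> b" using ab that by auto
    then show ?thesis unfolding abs_mult by (intro mult_mono) auto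
  qed
  then show "\<exists>b. \<forall>x\<in>space Q. \<bar>f x * g x\<bar> \<le> b" by blast
qed simp

lemma bounded_measurable_sum:
  "(\<And>i. i \<in> I \<Longrightarrow> bounded_measurable Q (f i)) \<Longrightarrow> bounded_measurable Q (\<lambda>x. \<Sum>i\<in>I. f i x)"
  by (induction I rule: infinite_finite_induct) (auto intro: bounded_measurable_add)

lemma bounded_measurable_comp:
  assumes "bounded_measurable Q f" "T \<in> measurable P Q"
  shows "bounded_measurable P (\<lambda>x. f (T x))"
  using assms measurable_space[OF assms(2)] unfolding bounded_measurable_def by auto

lemma (in finite_measure) integrable_bounded_measurable:
  "bounded_measurable M f \<Longrightarrow> integrable M f"
  unfolding bounded_measurable_def by (metis AE_I2 integrable_const_bound real_norm_def)

lemma bounded_mat_fun_carrier: "bounded_mat_fun Q n F \<Longrightarrow> x \<in> space Q \<Longrightarrow> F x \<in> carrier_mat n n"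
  by (simp add: bounded_mat_fun_def)

lemma bounded_mat_fun_entry:
  "bounded_mat_fun Q n F \<Longrightarrow> i < n \<Longrightarrow> j < n \<Longrightarrow> bounded_measurable Q (\<lambda>x. F x $$ (i, j))"
  by (simp add: bounded_mat_fun_def)

lemma bounded_mat_fun_cong:
  "(\<And>x. x \<in> space Q \<Longrightarrow> F x = G x) \<Longrightarrow> bounded_mat_fun Q n F \<longleftrightarrow> bounded_mat_fun Q n G"
  unfolding bounded_mat_fun_def
  by (intro conj_cong ball_cong all_cong imp_cong refl bounded_measurable_cong) auto

lemma bounded_mat_fun_comp:
  assumes "bounded_mat_fun Q n F" "T \<in> measurable P Q"
  shows "bounded_mat_fun P n (\<lambda>x. F (T x))"
  using assms measurable_space[OF assms(2)] bounded_measurable_comp[OF _ assms(2)]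
  unfolding bounded_mat_fun_def by blast

lemma bounded_mat_fun_mult:
  assumes "bounded_mat_fun Q n F" "bounded_mat_fun Q n G"
  shows "bounded_mat_fun Q n (\<lambda>x. F x * G x)"
  unfolding bounded_mat_fun_def
proof safe
  fix x assume "x \<in> space Q"
  then show "F x * G x \<in> carrier_mat n n"
    using assms by (meson bounded_mat_fun_carrier mult_carrier_mat)
next
  fix i j assume ij: "i < n" "j < n"
  have "bounded_measurable Q (\<lambda>x. \<Sum>k<n. F x $$ (i, k) * G x $$ (k, j))"
    using ij assms
    by (intro bounded_measurable_sum bounded_measurable_mult) (auto intro: bounded_mat_fun_entry)
  also have "?this \<longleftrightarrow> bounded_measurable Q (\<lambda>x. (F x * G x) $$ (i, j))"
  proof (rule bounded_measurable_cong)
    fix x assume "x \<in> space Q"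
    then have "F x \<in> carrier_mat n n" "G x \<in> carrier_mat n n"
      using assms by (auto intro: bounded_mat_fun_carrier)
    then show "(\<Sum>k<n. F x $$ (i, k) * G x $$ (k, j)) = (F x * G x) $$ (i, j)"
      using ij by (auto simp: scalar_prod_def atLeast0LessThan)
  qed
  finally show "bounded_measurable Q (\<lambda>x. (F x * G x) $$ (i, j))" .
qed

lemma bounded_mat_fun_pow:
  assumes "bounded_mat_fun Q n F"
  shows "bounded_mat_fun Q n (\<lambda>x. F x ^\<^sub>m k)"
proof (induction k)
  case 0
  have "bounded_mat_fun Q n (\<lambda>x. 1\<^sub>m n)"
    by (auto simp: bounded_mat_fun_def)
  also have "?this \<longleftrightarrow> bounded_mat_fun Q n (\<lambda>x. F x ^\<^sub>m 0)"
    using carrier_matD(1)[OF bounded_mat_fun_carrier[OF assms]]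
    by (intro bounded_mat_fun_cong) simp
  finally show ?case .
qed (use bounded_mat_fun_mult[OF _ assms] in simp)

lemma bounded_measurable_tr:
  assumes "bounded_mat_fun Q n F"
  shows "bounded_measurable Q (\<lambda>x. tr (F x))"
proof -
  have "bounded_measurable Q (\<lambda>x. \<Sum>i<n. F x $$ (i, i))"
    using assms by (intro bounded_measurable_sum) (auto intro: bounded_mat_fun_entry)
  also have "?this \<longleftrightarrow> bounded_measurable Q (\<lambda>x. tr (F x))"
    using bounded_mat_fun_carrier[OF assms]
    by (intro bounded_measurable_cong) (auto simp: tr_def)
  finally show ?thesis .
qed

text \<open>The Cauchy--Schwarz inequality for the form of \<open>A\<close> at two unit vectors bounds an entry by diagonal
  entries.  So the order hypotheses on the random matrices bound their entries.\<close>

lemma psd_entry_bound: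
  assumes A: "A \<in> sym_mats n" and psd: "loewner_le n (0\<^sub>m n n) A"
    and le: "loewner_le n A (r \<cdot>\<^sub>m 1\<^sub>m n)" and ij: "i < n" "j < n"
  shows "\<bar>A $$ (i, j)\<bar> \<le> r"
proof -
  have Ac: "A \<in> carrier_mat n n" using A by (rule sym_mats_carrier)
  have e: "unit_vec n i \<bullet> (A *\<^sub>v unit_vec n j) = A $$ (i, j)" if "i < n" "j < n" for i j
    using that Ac by (simp add: scalar_prod_left_unit[of _ n])
  have diag: "0 \<le> A $$ (i, i)" "A $$ (i, i) \<le> r" if "i < n" for i
  proof -
    show "0 \<le> A $$ (i, i)" using psd e[OF that that] unfolding psd_iff by (metis unit_vec_carrier)
    have "unit_vec n i \<bullet> (A *\<^sub>v unit_vec n i) \<le> unit_vec n i \<bullet> ((r \<cdot>\<^sub>m 1\<^sub>m n) *\<^sub>v unit_vec n i)"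
      using le unfolding loewner_le_def by simp
    then show "A $$ (i, i) \<le> r"
      using that by (simp add: e scaled_one_mult_vec[of _ n] scalar_prod_left_unit[of _ n])
  qed
  have "(A $$ (i, j))\<^sup>2 \<le> A $$ (i, i) * A $$ (j, j)"
    using psd_Cauchy_Schwarz[OF A psd, of "unit_vec n i" "unit_vec n j"] ij by (simp add: e)
  also have "\<dots> \<le> r * r" using diag[OF ij(1)] diag[OF ij(2)] by (intro mult_mono) auto
  finally have "(A $$ (i, j))\<^sup>2 \<le> r\<^sup>2" by (simp add: power2_eq_square)
  then show ?thesis using diag[OF ij(1)] by (simp add: abs_le_square_iff[symmetric])
qed

section \<open>The lower Chernoff tail for independent matrices\<close>

definition sum_mats :: "nat \<Rightarrow> (nat \<Rightarrow> real mat) \<Rightarrow> nat \<Rightarrow> real mat" where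
  "sum_mats n A m = mat n n (\<lambda>ij. \<Sum>l=1..m. A l $$ ij)"

lemma sum_mats_sym:
  assumes "\<And>l. l \<in> {1..m} \<Longrightarrow> A l \<in> sym_mats n"
  shows "sum_mats n A m \<in> sym_mats n"
proof (rule sym_matsI)
  have swap: "A l $$ (j, i) = A l $$ (i, j)" if "l \<in> {1..m}" "i < n" "j < n" for l i j
    using sym_mats_carrier[OF assms[OF that(1)]] sym_mats_transpose[OF assms[OF that(1)]] that
    by (metis carrier_matD index_transpose_mat(1))
  show "transpose_mat (sum_mats n A m) = sum_mats n A m"
    by (intro eq_matI) (auto simp: sum_mats_def intro!: sum.cong swap)
qed (simp add: sum_mats_def)

lemma sum_mats_quad:
  assumes "\<And>l. l \<in> {1..m} \<Longrightarrow> A l \<in> carrier_mat n n" and v: "v \<in> carrier_vec n"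
  shows "v \<bullet> (sum_mats n A m *\<^sub>v v) = (\<Sum>l=1..m. v \<bullet> (A l *\<^sub>v v))"
proof -
  have quad: "v \<bullet> (B *\<^sub>v v) = (\<Sum>i<n. \<Sum>j<n. v $ i * (B $$ (i, j) * v $ j))"
    if "B \<in> carrier_mat n n" for B
    using that v by (auto simp: scalar_prod_def atLeast0LessThan sum_distrib_left intro!: sum.cong)
  have "v \<bullet> (sum_mats n A m *\<^sub>v v) = (\<Sum>i<n. \<Sum>j<n. \<Sum>l=1..m. v $ i * (A l $$ (i, j) * v $ j))"
    by (subst quad) (auto simp: sum_mats_def sum_distrib_left sum_distrib_right)
  also have "\<dots> = (\<Sum>l=1..m. \<Sum>i<n. \<Sum>j<n. v $ i * (A l $$ (i, j) * v $ j))"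
    by (subst sum.swap, subst (2) sum.swap) (rule refl)
  also have "\<dots> = (\<Sum>l=1..m. v \<bullet> (A l *\<^sub>v v))"
    using assms by (intro sum.cong refl quad[symmetric]) auto
  finally show ?thesis .
qed

lemma sum_mats_Suc:
  assumes "A (Suc m) \<in> carrier_mat n n"
  shows "sum_mats n A (Suc m) = sum_mats n A m + A (Suc m)"
  using assms by (intro eq_matI) (auto simp: sum_mats_def)

text \<open>The random matrices are functions \<open>G (Y m)\<close> of independent variables with values in an arbitrary
  space: the independence that is given concerns the samples, of which the matrices are functions.\<close>

locale independent_psd_matrices = prob_space +
  fixes E :: "'b measure" and Y :: "nat \<Rightarrow> 'a \<Rightarrow> 'b" and G :: "'b \<Rightarrow> real mat"
    and n N :: nat and R c :: real
  assumes n_pos: "0 < n"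
    and indep: "indep_vars (\<lambda>_. E) Y {1..N}"
    and G_sym: "y \<in> space E \<Longrightarrow> G y \<in> sym_mats n"
    and G_meas: "i < n \<Longrightarrow> j < n \<Longrightarrow> (\<lambda>y. G y $$ (i, j)) \<in> borel_measurable E"
    and G_psd: "y \<in> space E \<Longrightarrow> loewner_le n (0\<^sub>m n n) (G y)"
    and G_le: "y \<in> space E \<Longrightarrow> loewner_le n (G y) (R \<cdot>\<^sub>m 1\<^sub>m n)"
    and N_pos: "0 < N"
    and R_pos: "0 < R" and c_pos: "0 < c"
    and mean_ge: "m \<in> {1..N} \<Longrightarrow> v \<in> carrier_vec n
      \<Longrightarrow> c * (v \<bullet> v) \<le> expectation (\<lambda>\<omega>. v \<bullet> (G (Y m \<omega>) *\<^sub>v v))"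
begin

lemma Y_meas: "m \<in> {1..N} \<Longrightarrow> Y m \<in> measurable M E"
  using indep by (simp add: indep_vars_def)

lemma G_bounded: "bounded_mat_fun E n G"
  unfolding bounded_mat_fun_def bounded_measurable_def
  using psd_entry_bound[OF G_sym G_psd G_le] G_meas sym_mats_carrier[OF G_sym] by blast

text \<open>The matrix \<open>B\<close> of the potential after the first \<open>m\<close> summands, with \<open>\<eta> = \<theta> / K\<close>.\<close>

definition shifted :: "real \<Rightarrow> nat \<Rightarrow> (nat \<Rightarrow> 'b) \<Rightarrow> real mat" where
  "shifted \<eta> m y = 1\<^sub>m n - \<eta> \<cdot>\<^sub>m sum_mats n (\<lambda>l. G (y l)) m"

lemma shifted_sym:
  assumes "\<And>l. l \<in> {1..m} \<Longrightarrow> y l \<in> space E"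
  shows "shifted \<eta> m y \<in> sym_mats n"
  unfolding shifted_def
  by (intro sym_mats_minus sym_mats_smult sum_mats_sym G_sym assms) (auto intro: sym_matsI)

lemma shifted_Suc:
  assumes "y (Suc m) \<in> space E"
  shows "shifted \<eta> (Suc m) y = shifted \<eta> m y - \<eta> \<cdot>\<^sub>m G (y (Suc m))"
  using sym_mats_carrier[OF G_sym[OF assms]] unfolding shifted_def
  by (subst sum_mats_Suc) (auto intro!: eq_matI simp: sum_mats_def algebra_simps)

lemma shifted_quad:
  assumes "\<And>l. l \<in> {1..m} \<Longrightarrow> y l \<in> space E" and v: "v \<in> carrier_vec n"
  shows "v \<bullet> (shifted \<eta> m y *\<^sub>v v) = v \<bullet> v - \<eta> * (\<Sum>l=1..m. v \<bullet> (G (y l) *\<^sub>v v))"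
proof -
  have S: "sum_mats n (\<lambda>l. G (y l)) m \<in> carrier_mat n n" by (simp add: sum_mats_def)
  have "v \<bullet> (shifted \<eta> m y *\<^sub>v v) = v \<bullet> v - \<eta> * (v \<bullet> (sum_mats n (\<lambda>l. G (y l)) m *\<^sub>v v))"
    using S v unfolding shifted_def
    by (simp add: minus_mat_mult_vec[of _ n] smult_mat_mult_vec[of _ n] closed_ops[of _ n]
        scalar_prod_minus_distrib[of _ n])
  then show ?thesis
    using sum_mats_quad[of m "\<lambda>l. G (y l)" n v] sym_mats_carrier[OF G_sym] assms by simp
qed

lemma shifted_bounds:
  assumes y: "\<And>l. l \<in> {1..m} \<Longrightarrow> y l \<in> space E" and \<eta>: "0 \<le> \<eta>"
  shows "loewner_le n (shifted \<eta> m y) (1\<^sub>m n)"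
    and "loewner_le n ((1 - \<eta> * (real m * R)) \<cdot>\<^sub>m 1\<^sub>m n) (shifted \<eta> m y)"
proof -
  have q: "0 \<le> v \<bullet> (G (y l) *\<^sub>v v)" "v \<bullet> (G (y l) *\<^sub>v v) \<le> R * (v \<bullet> v)"
    if "v \<in> carrier_vec n" "l \<in> {1..m}" for l v
    using G_psd[OF y[OF that(2)]] G_le[OF y[OF that(2)]] that(1)
    by (force simp: psd_iff loewner_le_def scaled_one_mult_vec[of _ n])+
  show "loewner_le n (shifted \<eta> m y) (1\<^sub>m n)"
    unfolding loewner_le_def using q \<eta> shifted_quad[of m y _ \<eta>] y
    by (auto intro!: mult_nonneg_nonneg sum_nonneg)
  show "loewner_le n ((1 - \<eta> * (real m * R)) \<cdot>\<^sub>m 1\<^sub>m n) (shifted \<eta> m y)"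
    unfolding loewner_le_def
  proof
    fix v :: "real vec" assume v: "v \<in> carrier_vec n"
    have "(\<Sum>l=1..m. v \<bullet> (G (y l) *\<^sub>v v)) \<le> (\<Sum>l=1..m. R * (v \<bullet> v))"
      using q v by (intro sum_mono) auto
    then have "\<eta> * (\<Sum>l=1..m. v \<bullet> (G (y l) *\<^sub>v v)) \<le> \<eta> * (real m * (R * (v \<bullet> v)))"
      using \<eta> by (intro mult_left_mono) auto
    then show "v \<bullet> (((1 - \<eta> * (real m * R)) \<cdot>\<^sub>m 1\<^sub>m n) *\<^sub>v v) \<le> v \<bullet> (shifted \<eta> m y *\<^sub>v v)"
      using v shifted_quad[of m y v \<eta>] y by (simp add: scaled_one_mult_vec[of _ n] algebra_simps)
  qed
qed

lemma shifted_bounded: "bounded_mat_fun (PiM {1..m} (\<lambda>_. E)) n (shifted \<eta> m)"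
  unfolding bounded_mat_fun_def
proof safe
  fix y show "shifted \<eta> m y \<in> carrier_mat n n" by (auto simp: shifted_def sum_mats_def)
next
  fix i j assume ij: "i < n" "j < n"
  have "bounded_measurable (PiM {1..m} (\<lambda>_. E))
      (\<lambda>y. (if i = j then 1 else 0) + (- \<eta>) * (\<Sum>l=1..m. G (y l) $$ (i, j)))"
    using ij
    by (intro bounded_measurable_add bounded_measurable_mult bounded_measurable_sum
        bounded_measurable_const bounded_measurable_comp[OF bounded_mat_fun_entry[OF G_bounded]]
        measurable_component_singleton) auto
  then show "bounded_measurable (PiM {1..m} (\<lambda>_. E)) (\<lambda>y. shifted \<eta> m y $$ (i, j))"
    using ij by (simp add: shifted_def sum_mats_def)
qed

text \<open>Restricting to the indices up to \<open>m\<close> puts the past into the product space for which independence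
  of disjoint blocks is stated.\<close>

definition history :: "nat \<Rightarrow> 'a \<Rightarrow> nat \<Rightarrow> 'b" where
  "history m \<omega> = (\<lambda>l\<in>{1..m}. Y l \<omega>)"

lemma history_meas: "m \<le> N \<Longrightarrow> history m \<in> measurable M (PiM {1..m} (\<lambda>_. E))"
  unfolding history_def[abs_def] by (intro measurable_restrict Y_meas) auto

lemma history_space: "m \<le> N \<Longrightarrow> \<omega> \<in> space M \<Longrightarrow> l \<in> {1..m} \<Longrightarrow> history m \<omega> l \<in> space E"
  using measurable_space[OF Y_meas[of l]] by (auto simp: history_def)

text \<open>By independence the expectation of \<open>tr (A D)\<close>, for the new summand \<open>A\<close> and \<open>D\<close> a function of the
  past, equals that of \<open>tr ((\<integral>A) D)\<close>.  Now \<open>\<integral>A \<ge> c\<close>, and \<open>D\<close> is an even power.\<close>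

lemma expectation_tr_step_ge:
  assumes m: "Suc m \<le> N"
  shows "c * expectation (\<lambda>\<omega>. tr (shifted \<eta> m (history m \<omega>) ^\<^sub>m (2 * k)))
       \<le> expectation (\<lambda>\<omega>. tr (G (Y (Suc m) \<omega>) * shifted \<eta> m (history m \<omega>) ^\<^sub>m (2 * k)))"
proof -
  define D where "D y = shifted \<eta> m y ^\<^sub>m (2 * k)" for y
  have D: "bounded_mat_fun (PiM {1..m} (\<lambda>_. E)) n D"
    unfolding D_def[abs_def] by (intro bounded_mat_fun_pow shifted_bounded)
  have pm: "history m \<in> measurable M (PiM {1..m} (\<lambda>_. E))" and Ym: "Y (Suc m) \<in> measurable M E"
    using m history_meas Y_meas[of "Suc m"] by auto
  have Gb: "bounded_measurable M (\<lambda>\<omega>. G (Y (Suc m) \<omega>) $$ (i, j))" if "i < n" "j < n" for i j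
    using that by (intro bounded_measurable_comp[OF _ Ym] bounded_mat_fun_entry[OF G_bounded])
  have Db: "bounded_measurable M (\<lambda>\<omega>. D (history m \<omega>) $$ (i, j))" if "i < n" "j < n" for i j
    using that by (intro bounded_measurable_comp[OF _ pm] bounded_mat_fun_entry[OF D])
  have Gc: "G (Y (Suc m) \<omega>) \<in> carrier_mat n n" if "\<omega> \<in> space M" for \<omega>
    using bounded_mat_fun_carrier[OF G_bounded] measurable_space[OF Ym that] .
  have Dc: "D (history m \<omega>) \<in> carrier_mat n n" if "\<omega> \<in> space M" for \<omega>
    using bounded_mat_fun_carrier[OF D] measurable_space[OF pm that] .
  define A where "A = mat n n (\<lambda>ij. expectation (\<lambda>\<omega>. G (Y (Suc m) \<omega>) $$ ij))"
  have Ac: "A \<in> carrier_mat n n" by (simp add: A_def)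
  have A_ge: "loewner_le n (c \<cdot>\<^sub>m 1\<^sub>m n) A"
    unfolding loewner_le_def
  proof
    fix v :: "real vec" assume v: "v \<in> carrier_vec n"
    have quad: "v \<bullet> (B *\<^sub>v v) = (\<Sum>i<n. \<Sum>j<n. (v $ i * v $ j) * B $$ (i, j))"
      if "B \<in> carrier_mat n n" for B
      using that v
      by (auto simp: scalar_prod_def atLeast0LessThan sum_distrib_left mult_ac intro!: sum.cong)
    have "c * (v \<bullet> v) \<le> expectation (\<lambda>\<omega>. v \<bullet> (G (Y (Suc m) \<omega>) *\<^sub>v v))"
      using m v by (intro mean_ge) auto
    also have "\<dots> = expectation (\<lambda>\<omega>. \<Sum>i<n. \<Sum>j<n. (v $ i * v $ j) * G (Y (Suc m) \<omega>) $$ (i, j))"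
      using Gc by (intro Bochner_Integration.integral_cong refl quad)
    also have "\<dots> = (\<Sum>i<n. \<Sum>j<n. (v $ i * v $ j) * A $$ (i, j))"
      using integrable_bounded_measurable[OF Gb]
      by (subst Bochner_Integration.integral_sum Bochner_Integration.integral_mult_right_zero
          | auto simp: A_def intro!: sum.cong)+
    also have "\<dots> = v \<bullet> (A *\<^sub>v v)" using quad[OF Ac] by simp
    finally show "v \<bullet> ((c \<cdot>\<^sub>m 1\<^sub>m n) *\<^sub>v v) \<le> v \<bullet> (A *\<^sub>v v)"
      using v by (simp add: scaled_one_mult_vec[of _ n])
  qed
  have prod_exp: "expectation (\<lambda>\<omega>. G (Y (Suc m) \<omega>) $$ (i, j) * D (history m \<omega>) $$ (j, i))
      = A $$ (i, j) * expectation (\<lambda>\<omega>. D (history m \<omega>) $$ (j, i))" if ij: "i < n" "j < n" for i j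
  proof -
    have "indep_var (PiM {Suc m} (\<lambda>_. E)) (\<lambda>\<omega>. \<lambda>l\<in>{Suc m}. Y l \<omega>)
        (PiM {1..m} (\<lambda>_. E)) (\<lambda>\<omega>. \<lambda>l\<in>{1..m}. Y l \<omega>)"
      using m by (intro indep_var_restrict[OF indep]) auto
    moreover have "(\<lambda>y. G (y (Suc m)) $$ (i, j)) \<in> borel_measurable (PiM {Suc m} (\<lambda>_. E))"
      using G_meas[OF ij] by measurable
    moreover have "(\<lambda>y. D y $$ (j, i)) \<in> borel_measurable (PiM {1..m} (\<lambda>_. E))"
      using bounded_mat_fun_entry[OF D ij(2,1)] by (simp add: bounded_measurable_def)
    ultimately have "indep_var borel ((\<lambda>y. G (y (Suc m)) $$ (i, j)) \<circ> (\<lambda>\<omega>. \<lambda>l\<in>{Suc m}. Y l \<omega>))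
        borel ((\<lambda>y. D y $$ (j, i)) \<circ> (\<lambda>\<omega>. \<lambda>l\<in>{1..m}. Y l \<omega>))"
      by (rule indep_var_compose)
    then have "indep_var borel (\<lambda>\<omega>. G (Y (Suc m) \<omega>) $$ (i, j)) borel (\<lambda>\<omega>. D (history m \<omega>) $$ (j, i))"
      by (simp add: comp_def history_def)
    then show ?thesis
      using integrable_bounded_measurable[OF Gb[OF ij]] integrable_bounded_measurable[OF Db[OF ij(2,1)]]
      by (subst indep_var_lebesgue_integral) (auto simp: A_def ij)
  qed
  have intD: "integrable M (\<lambda>\<omega>. D (history m \<omega>) $$ (i, j))" if "i < n" "j < n" for i j
    using integrable_bounded_measurable[OF Db[OF that]] .
  have "c * expectation (\<lambda>\<omega>. tr (D (history m \<omega>))) = expectation (\<lambda>\<omega>. c * tr (D (history m \<omega>)))"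
    by simp
  also have "\<dots> \<le> expectation (\<lambda>\<omega>. tr (A * D (history m \<omega>)))"
  proof (intro integral_mono)
    show "integrable M (\<lambda>\<omega>. c * tr (D (history m \<omega>)))"
      by (intro integrable_mult_right integrable_bounded_measurable
          bounded_measurable_comp[OF bounded_measurable_tr[OF D] pm])
    have "bounded_mat_fun (PiM {1..m} (\<lambda>_. E)) n (\<lambda>_. A)"
      using Ac by (simp add: bounded_mat_fun_def)
    from bounded_measurable_tr[OF bounded_mat_fun_mult[OF this D]]
    show "integrable M (\<lambda>\<omega>. tr (A * D (history m \<omega>)))"
      by (intro integrable_bounded_measurable bounded_measurable_comp[OF _ pm])
    fix \<omega> assume \<omega>: "\<omega> \<in> space M"
    have "shifted \<eta> m (history m \<omega>) \<in> sym_mats n"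
      using m \<omega> history_space[of m \<omega>] by (intro shifted_sym) auto
    then have "tr ((c \<cdot>\<^sub>m 1\<^sub>m n) * D (history m \<omega>)) \<le> tr (A * D (history m \<omega>))"
      unfolding D_def using Ac A_ge by (intro tr_even_pow_mono[of _ n]) auto
    then show "c * tr (D (history m \<omega>)) \<le> tr (A * D (history m \<omega>))"
      using Dc[OF \<omega>] tr_smult[of "D (history m \<omega>)" n c]
      by (simp add: smult_mult_mat[of _ n] one_mult_mat[of _ n])
  qed
  also have "\<dots> = expectation (\<lambda>\<omega>. \<Sum>i<n. \<Sum>j<n. A $$ (i, j) * D (history m \<omega>) $$ (j, i))"
    using Dc by (intro Bochner_Integration.integral_cong refl tr_mult[OF Ac])
  also have "\<dots> = (\<Sum>i<n. \<Sum>j<n. A $$ (i, j) * expectation (\<lambda>\<omega>. D (history m \<omega>) $$ (j, i)))"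
    using intD by (subst Bochner_Integration.integral_sum | auto intro!: sum.cong)+
  also have "\<dots> = (\<Sum>i<n. \<Sum>j<n. expectation (\<lambda>\<omega>. G (Y (Suc m) \<omega>) $$ (i, j) * D (history m \<omega>) $$ (j, i)))"
    by (intro sum.cong refl) (auto simp: prod_exp)
  also have "\<dots> = expectation (\<lambda>\<omega>. \<Sum>i<n. \<Sum>j<n. G (Y (Suc m) \<omega>) $$ (i, j) * D (history m \<omega>) $$ (j, i))"
    using integrable_bounded_measurable[OF bounded_measurable_mult[OF Gb Db]]
    by (subst Bochner_Integration.integral_sum | auto intro!: sum.cong)+
  also have "\<dots> = expectation (\<lambda>\<omega>. tr (G (Y (Suc m) \<omega>) * D (history m \<omega>)))"
    using Gc Dc by (intro Bochner_Integration.integral_cong refl tr_mult[symmetric])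
  finally show ?thesis by (simp only: D_def)
qed

text \<open>The induction over the summands: \<open>tr_pow_minus_le\<close> for every outcome, then \<open>expectation_tr_step_ge\<close>,
  and \<open>tr B\<^sup>2\<^sup>k \<ge> tr B\<^sup>K\<close> since \<open>B \<le> 1\<close>.  The number \<open>\<beta>\<close> is a lower bound for \<open>B\<close> that holds after
  all \<open>N\<close> steps and hence after fewer.\<close>

lemma expectation_tr_pow_le:
  assumes \<eta>: "0 < \<eta>" and \<beta>: "\<beta> = 1 - \<eta> * (real N * R)" "0 < \<beta>" and k: "1 \<le> k" and m: "m \<le> N"
  defines "K \<equiv> 2 * k + 1"
  shows "expectation (\<lambda>\<omega>. tr (shifted \<eta> m (history m \<omega>) ^\<^sub>m K))
       \<le> real n * exp (- (real m * (\<beta> * (c / R) * (1 - exp (- (real K * \<eta> * R))))))"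
  using m
proof (induction m)
  case 0
  have "shifted \<eta> 0 y = 1\<^sub>m n" for y
    by (auto simp: shifted_def sum_mats_def)
  moreover have "1\<^sub>m n ^\<^sub>m K = (1\<^sub>m n :: real mat)"
    by (induction K) auto
  ultimately show ?case by (simp add: tr_one prob_space)
next
  case (Suc m)
  define B where "B j \<omega> = shifted \<eta> j (history j \<omega>)" for j \<omega>
  define w where "w = \<beta> / R * (1 - exp (- (real K * \<eta> * R)))"
  define x where "x = w * c"
  have w0: "0 \<le> w" using \<beta> R_pos \<eta> by (simp add: w_def)
  have x: "x = \<beta> * (c / R) * (1 - exp (- (real K * \<eta> * R)))" by (simp add: x_def w_def)
  have ps: "history j \<omega> l \<in> space E" if "\<omega> \<in> space M" "j \<le> N" "l \<in> {1..j}" for \<omega> j l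
    using history_space that by blast
  have bnd: "bounded_mat_fun M n (\<lambda>\<omega>. B j \<omega>)" if "j \<le> N" for j
    unfolding B_def[abs_def]
    by (rule bounded_mat_fun_comp[OF shifted_bounded history_meas[OF that]])
  have int: "integrable M (\<lambda>\<omega>. tr (B j \<omega> ^\<^sub>m i))" if "j \<le> N" for i j
    using that by (intro integrable_bounded_measurable bounded_measurable_tr[where n = n] bounded_mat_fun_pow bnd)
  have Gbnd: "bounded_mat_fun M n (\<lambda>\<omega>. G (Y (Suc m) \<omega>))"
    using Suc.prems by (intro bounded_mat_fun_comp[OF G_bounded] Y_meas) auto
  have intG: "integrable M (\<lambda>\<omega>. tr (G (Y (Suc m) \<omega>) * B m \<omega> ^\<^sub>m (2 * k)))"
    using Suc.prems
    by (intro integrable_bounded_measurable bounded_measurable_tr[where n = n] bounded_mat_fun_mult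
        bounded_mat_fun_pow Gbnd bnd) auto
  have Bsym: "B j \<omega> \<in> sym_mats n" if "j \<le> N" "\<omega> \<in> space M" for j \<omega>
    unfolding B_def using that ps by (intro shifted_sym) auto
  have lower: "loewner_le n (\<beta> \<cdot>\<^sub>m 1\<^sub>m n) (B j \<omega>)" if "j \<le> N" "\<omega> \<in> space M" for j \<omega>
    unfolding loewner_le_def
  proof
    fix v :: "real vec" assume v: "v \<in> carrier_vec n"
    have "0 \<le> v \<bullet> v" by (simp add: scalar_prod_def sum_nonneg)
    moreover have "\<beta> \<le> 1 - \<eta> * (real j * R)"
      using that \<eta> R_pos by (simp add: \<beta>(1))
    ultimately have "\<beta> * (v \<bullet> v) \<le> (1 - \<eta> * (real j * R)) * (v \<bullet> v)"
      by (intro mult_right_mono)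
    also have "\<dots> \<le> v \<bullet> (B j \<omega> *\<^sub>v v)"
      using shifted_bounds(2)[of j "history j \<omega>" \<eta>] ps[OF that(2,1)] \<eta> v
      unfolding B_def loewner_le_def by (auto simp: scaled_one_mult_vec[of _ n])
    finally show "v \<bullet> ((\<beta> \<cdot>\<^sub>m 1\<^sub>m n) *\<^sub>v v) \<le> v \<bullet> (B j \<omega> *\<^sub>v v)"
      using v by (simp add: scaled_one_mult_vec[of _ n])
  qed
  have pow_mono: "tr (B m \<omega> ^\<^sub>m K) \<le> tr (B m \<omega> ^\<^sub>m (2 * k))" if \<omega>: "\<omega> \<in> space M" for \<omega>
  proof -
    have B: "B m \<omega> \<in> sym_mats n" using Bsym[of m] Suc.prems \<omega> by simp
    have Bc: "B m \<omega> \<in> carrier_mat n n" using B by (rule sym_mats_carrier)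
    have "tr (B m \<omega> ^\<^sub>m K) = tr (B m \<omega> * B m \<omega> ^\<^sub>m (2 * k))"
      using pow_mat_commute[OF Bc, of "2 * k"] by (simp add: K_def)
    also have "\<dots> \<le> tr (1\<^sub>m n * B m \<omega> ^\<^sub>m (2 * k))"
      using shifted_bounds(1)[of m "history m \<omega>" \<eta>] ps[OF \<omega>, of m] Suc.prems \<eta> Bc
      by (intro tr_even_pow_mono[OF B]) (auto simp: B_def)
    also have "\<dots> = tr (B m \<omega> ^\<^sub>m (2 * k))"
      using Bc by (simp add: one_mult_mat[of _ n])
    finally show ?thesis .
  qed
  have step: "tr (B (Suc m) \<omega> ^\<^sub>m K) \<le> tr (B m \<omega> ^\<^sub>m K) - w * tr (G (Y (Suc m) \<omega>) * B m \<omega> ^\<^sub>m (2 * k))"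
    if \<omega>: "\<omega> \<in> space M" for \<omega>
  proof -
    define A where "A = G (Y (Suc m) \<omega>)"
    have yE: "Y (Suc m) \<omega> \<in> space E" using ps[OF \<omega> Suc.prems, of "Suc m"] by (simp add: history_def)
    have A: "A \<in> sym_mats n" "loewner_le n (0\<^sub>m n n) A" "loewner_le n A (R \<cdot>\<^sub>m 1\<^sub>m n)"
      using G_sym[OF yE] G_psd[OF yE] G_le[OF yE] by (simp_all add: A_def)
    have Ac: "A \<in> carrier_mat n n" using A(1) by (rule sym_mats_carrier)
    have Bm: "B m \<omega> \<in> sym_mats n" using Bsym[of m] Suc.prems \<omega> by simp
    have Bc: "B m \<omega> \<in> carrier_mat n n" using Bm by (rule sym_mats_carrier)
    have "shifted \<eta> m (history (Suc m) \<omega>) = shifted \<eta> m (history m \<omega>)"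
      by (auto simp: shifted_def sum_mats_def history_def intro!: eq_matI sum.cong)
    then have BS: "B (Suc m) \<omega> = B m \<omega> - \<eta> \<cdot>\<^sub>m A"
      unfolding B_def A_def using ps[OF \<omega> Suc.prems, of "Suc m"]
      by (subst shifted_Suc) (auto simp: history_def)
    have "tr ((B m \<omega> - \<eta> \<cdot>\<^sub>m A) ^\<^sub>m (2 * k + 1))
        \<le> tr (B m \<omega> ^\<^sub>m (2 * k + 1)) - \<beta> / (\<eta> * R) * (1 - exp (- (real (2 * k + 1) * (\<eta> * R))))
            * tr ((\<eta> \<cdot>\<^sub>m A) * B m \<omega> ^\<^sub>m (2 * k))"
    proof (rule tr_pow_minus_le[OF Bm])
      show "loewner_le n (0\<^sub>m n n) (\<eta> \<cdot>\<^sub>m A)" "loewner_le n (\<eta> \<cdot>\<^sub>m A) ((\<eta> * R) \<cdot>\<^sub>m 1\<^sub>m n)"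
        using A Ac \<eta> by (auto simp: psd_iff loewner_le_def smult_mat_mult_vec[of _ n] closed_ops[of _ n]
            scaled_one_mult_vec[of _ n] mult.assoc)
      show "loewner_le n (\<beta> \<cdot>\<^sub>m 1\<^sub>m n) (B m \<omega> - \<eta> \<cdot>\<^sub>m A)"
        using lower[OF Suc.prems \<omega>] by (simp add: BS)
      show "\<beta> \<le> 1" using \<eta> R_pos by (simp add: \<beta>(1))
    qed (use A \<eta> R_pos \<beta> k in auto)
    also have "tr ((\<eta> \<cdot>\<^sub>m A) * B m \<omega> ^\<^sub>m (2 * k)) = \<eta> * tr (A * B m \<omega> ^\<^sub>m (2 * k))"
      using Ac Bc tr_smult[of "A * B m \<omega> ^\<^sub>m (2 * k)" n \<eta>]
      by (simp add: smult_mult_mat[of _ n] closed_ops[of _ n])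
    finally show ?thesis
      using \<eta> by (simp add: BS A_def w_def K_def mult.assoc)
  qed
  have m: "m \<le> N" using Suc.prems by simp
  have E0: "0 \<le> expectation (\<lambda>\<omega>. tr (B m \<omega> ^\<^sub>m K))"
  proof (intro integral_nonneg_AE AE_I2)
    fix \<omega> assume \<omega>: "\<omega> \<in> space M"
    have Bm: "B m \<omega> \<in> sym_mats n" using Bsym[OF m \<omega>] .
    have "loewner_le n (0\<^sub>m n n) (B m \<omega>)"
      unfolding psd_iff
    proof
      fix v :: "real vec" assume v: "v \<in> carrier_vec n"
      have "0 \<le> \<beta> * (v \<bullet> v)" using \<beta>(2) by (simp add: scalar_prod_def sum_nonneg)
      also have "\<dots> \<le> v \<bullet> (B m \<omega> *\<^sub>v v)"
        using lower[OF m \<omega>] v by (force simp: loewner_le_def scaled_one_mult_vec[of _ n])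
      finally show "0 \<le> v \<bullet> (B m \<omega> *\<^sub>v v)" .
    qed
    from psd_congruence(2)[OF one_carrier_mat _ psd_pow[OF Bm this]]
    show "0 \<le> tr (B m \<omega> ^\<^sub>m K)"
      using sym_mats_carrier[OF sym_mats_pow[OF Bm]] by (simp add: one_mult_mat[of _ n])
  qed
  have "expectation (\<lambda>\<omega>. tr (B (Suc m) \<omega> ^\<^sub>m K))
      \<le> expectation (\<lambda>\<omega>. tr (B m \<omega> ^\<^sub>m K) - w * tr (G (Y (Suc m) \<omega>) * B m \<omega> ^\<^sub>m (2 * k)))"
    using int[OF Suc.prems, of K] int[OF m, of K] intG step
    by (intro integral_mono Bochner_Integration.integrable_diff integrable_mult_right) auto
  also have "\<dots> = expectation (\<lambda>\<omega>. tr (B m \<omega> ^\<^sub>m K))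
      - w * expectation (\<lambda>\<omega>. tr (G (Y (Suc m) \<omega>) * B m \<omega> ^\<^sub>m (2 * k)))"
    using int[OF m, of K] intG by simp
  also have "\<dots> \<le> expectation (\<lambda>\<omega>. tr (B m \<omega> ^\<^sub>m K)) - w * (c * expectation (\<lambda>\<omega>. tr (B m \<omega> ^\<^sub>m K)))"
  proof -
    have "c * expectation (\<lambda>\<omega>. tr (B m \<omega> ^\<^sub>m K)) \<le> c * expectation (\<lambda>\<omega>. tr (B m \<omega> ^\<^sub>m (2 * k)))"
      using c_pos int[OF m] pow_mono by (intro mult_left_mono integral_mono) auto
    also have "\<dots> \<le> expectation (\<lambda>\<omega>. tr (G (Y (Suc m) \<omega>) * B m \<omega> ^\<^sub>m (2 * k)))"
      unfolding B_def by (rule expectation_tr_step_ge[OF Suc.prems])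
    finally show ?thesis using w0 by (intro diff_left_mono mult_left_mono)
  qed
  also have "\<dots> = (1 - x) * expectation (\<lambda>\<omega>. tr (B m \<omega> ^\<^sub>m K))"
    by (simp add: x_def algebra_simps)
  also have "\<dots> \<le> exp (- x) * expectation (\<lambda>\<omega>. tr (B m \<omega> ^\<^sub>m K))"
    using E0 exp_ge_add_one_self[of "- x"] by (intro mult_right_mono) auto
  also have "\<dots> \<le> exp (- x) * (real n * exp (- (real m * x)))"
    using Suc.IH[OF m] by (intro mult_left_mono) (auto simp: B_def x)
  also have "\<dots> = real n * exp (- (real (Suc m) * x))"
    by (simp add: exp_add[symmetric] algebra_simps flip: exp_add)
  finally show ?case by (simp add: B_def x)
qed

text \<open>Markov's inequality for \<open>tr B\<^sup>K\<close>.  The matrix \<open>H\<close> may differ from the average on a null set,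
  which absorbs exceptional values of the summands.\<close>

lemma tail_le_pow:
  assumes \<theta>: "0 < \<theta>" and k: "1 \<le> k" and \<beta>: "\<beta> = 1 - \<theta> / real (2 * k + 1) * (real N * R)" "0 < \<beta>"
    and t: "0 < 1 - \<theta> / real (2 * k + 1) * (real N * t)"
    and H: "AE \<omega> in M. H \<omega> = (1 / real N) \<cdot>\<^sub>m sum_mats n (\<lambda>l. G (Y l \<omega>)) N"
  shows "prob {\<omega> \<in> space M. lambda_min (H \<omega>) \<le> t}
       \<le> real n * exp (- (real N * (\<beta> * (c / R) * (1 - exp (- (\<theta> * R))))))
           / (\<beta> * (1 - \<theta> / real (2 * k + 1) * (real N * t)) ^ (2 * k))"
proof -
  define \<eta> where "\<eta> = \<theta> / real (2 * k + 1)"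
  have \<eta>: "0 < \<eta>" using \<theta> by (simp add: \<eta>_def)
  have \<eta>_K: "real (2 * k + 1) * \<eta> = \<theta>" by (simp add: \<eta>_def)
  define Z where "Z \<omega> = tr (shifted \<eta> N (history N \<omega>) ^\<^sub>m (2 * k + 1))" for \<omega>
  define a where "a = \<beta> * (1 - \<eta> * (real N * t)) ^ (2 * k)"
  have a: "0 < a" using \<beta>(2) t by (simp add: a_def \<eta>_def)
  have sp: "Y l \<omega> \<in> space E" if "\<omega> \<in> space M" "l \<in> {1..N}" for \<omega> l
    using measurable_space[OF Y_meas] that by blast
  have Z_bm: "bounded_measurable M Z"
    unfolding Z_def[abs_def]
    by (rule bounded_measurable_comp[OF bounded_measurable_tr[OF bounded_mat_fun_pow[OF shifted_bounded]]
          history_meas]) simp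
  have Z_int: "integrable M Z" using Z_bm by (rule integrable_bounded_measurable)
  have Bsym: "shifted \<eta> N (history N \<omega>) \<in> sym_mats n"
    and lower: "loewner_le n (\<beta> \<cdot>\<^sub>m 1\<^sub>m n) (shifted \<eta> N (history N \<omega>))"
    if "\<omega> \<in> space M" for \<omega>
    using shifted_sym[of N "history N \<omega>" \<eta>] shifted_bounds(2)[of N "history N \<omega>" \<eta>] \<eta>
      history_space[of N \<omega>] that
    by (auto simp: \<beta>(1) \<eta>_def)
  have Z_ge: "a \<le> Z \<omega>"
    if \<omega>: "\<omega> \<in> space M" and H: "H \<omega> = (1 / real N) \<cdot>\<^sub>m sum_mats n (\<lambda>l. G (Y l \<omega>)) N"
      and le: "lambda_min (H \<omega>) \<le> t" for \<omega>
  proof -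
    define S where "S = sum_mats n (\<lambda>l. G (Y l \<omega>)) N"
    have S: "S \<in> sym_mats n" unfolding S_def using sp[OF \<omega>] by (intro sum_mats_sym G_sym) auto
    have Sc: "S \<in> carrier_mat n n" using S by (rule sym_mats_carrier)
    have Hs: "H \<omega> \<in> sym_mats n" unfolding H S_def[symmetric] using S by (rule sym_mats_smult)
    obtain v where v: "v \<in> carrier_vec n" "v \<noteq> 0\<^sub>v n" and ev: "H \<omega> *\<^sub>v v = lambda_min (H \<omega>) \<cdot>\<^sub>v v"
      by (rule lambda_min_eigenvector[OF Hs n_pos])
    define l where "l = lambda_min (H \<omega>)"
    have Hv: "H \<omega> *\<^sub>v v = (1 / real N) \<cdot>\<^sub>v (S *\<^sub>v v)"
      unfolding H S_def[symmetric] using Sc v(1) by (simp add: smult_mat_mult_vec[of _ n])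
    have Sv: "S *\<^sub>v v = (real N * l) \<cdot>\<^sub>v v"
    proof -
      have "S *\<^sub>v v = real N \<cdot>\<^sub>v ((1 / real N) \<cdot>\<^sub>v (S *\<^sub>v v))"
        using N_pos by (simp add: smult_smult_assoc)
      also have "\<dots> = real N \<cdot>\<^sub>v (l \<cdot>\<^sub>v v)"
        unfolding Hv[symmetric] ev l_def[symmetric] ..
      finally show ?thesis by (simp add: smult_smult_assoc)
    qed
    have B: "shifted \<eta> N (history N \<omega>) = 1\<^sub>m n - \<eta> \<cdot>\<^sub>m S"
      by (auto simp: shifted_def S_def sum_mats_def history_def intro!: eq_matI sum.cong)
    have Bv: "shifted \<eta> N (history N \<omega>) *\<^sub>v v = (1 - \<eta> * (real N * l)) \<cdot>\<^sub>v v"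
    proof -
      have "(1\<^sub>m n - \<eta> \<cdot>\<^sub>m S) *\<^sub>v v = v - \<eta> \<cdot>\<^sub>v ((real N * l) \<cdot>\<^sub>v v)"
        using Sc v(1) by (simp add: minus_mat_mult_vec[of _ n] smult_mat_mult_vec[of _ n]
            closed_ops[of _ n] Sv)
      also have "\<dots> = (1 - \<eta> * (real N * l)) \<cdot>\<^sub>v v"
        by (intro eq_vecI) (auto simp: algebra_simps)
      finally show ?thesis unfolding B .
    qed
    have "1 - \<eta> * (real N * t) \<le> 1 - \<eta> * (real N * l)"
      using le \<eta> by (simp add: l_def mult_left_mono)
    then have "a \<le> \<beta> * (1 - \<eta> * (real N * l)) ^ (2 * k)"
      using t \<beta>(2) unfolding a_def by (intro mult_left_mono power_mono) (auto simp: \<eta>_def)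
    also have "\<dots> \<le> Z \<omega>"
      unfolding Z_def using \<beta>(2) by (intro tr_odd_pow_ge_eigenvalue[OF Bsym[OF \<omega>] lower[OF \<omega>] _ v Bv]) simp
    finally show ?thesis .
  qed
  have Z_nonneg: "0 \<le> Z \<omega>" if \<omega>: "\<omega> \<in> space M" for \<omega>
  proof -
    define B where "B = shifted \<eta> N (history N \<omega>)"
    have B: "B \<in> sym_mats n" "loewner_le n (\<beta> \<cdot>\<^sub>m 1\<^sub>m n) B"
      using Bsym[OF \<omega>] lower[OF \<omega>] by (simp_all add: B_def)
    obtain v where v: "v \<in> carrier_vec n" "v \<noteq> 0\<^sub>v n" and ev: "B *\<^sub>v v = lambda_min B \<cdot>\<^sub>v v"
      by (rule lambda_min_eigenvector[OF B(1) n_pos])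
    have "0 \<le> \<beta> * lambda_min B ^ (2 * k)" using \<beta>(2) by simp
    also have "\<dots> \<le> Z \<omega>"
      unfolding Z_def B_def[symmetric] using \<beta>(2) by (intro tr_odd_pow_ge_eigenvalue[OF B _ v ev]) simp
    finally show ?thesis .
  qed
  have "prob {\<omega> \<in> space M. lambda_min (H \<omega>) \<le> t} \<le> prob {\<omega> \<in> space M. a \<le> Z \<omega>}"
  proof (rule finite_measure_mono_AE)
    show "AE \<omega> in M. \<omega> \<in> {\<omega> \<in> space M. lambda_min (H \<omega>) \<le> t} \<longrightarrow> \<omega> \<in> {\<omega> \<in> space M. a \<le> Z \<omega>}"
      using H by eventually_elim (auto intro: Z_ge)
    show "{\<omega> \<in> space M. a \<le> Z \<omega>} \<in> events"
      using Z_int by measurable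
  qed
  also have "\<dots> \<le> expectation Z / a"
    using Z_nonneg by (intro integral_Markov_inequality_measure[OF Z_int sets.empty_sets _ a]) auto
  also have "\<dots> \<le> real n * exp (- (real N * (\<beta> * (c / R) * (1 - exp (- (\<theta> * R)))))) / a"
  proof -
    have "expectation Z \<le> real n * exp (- (real N * (\<beta> * (c / R) * (1 - exp (- (real (2 * k + 1) * \<eta> * R))))))"
      unfolding Z_def[abs_def]
      by (rule expectation_tr_pow_le) (use \<eta> \<beta> k in \<open>auto simp: \<eta>_def\<close>)
    then show ?thesis unfolding \<eta>_K using a by (intro divide_right_mono) auto
  qed
  finally show ?thesis by (simp only: a_def \<eta>_def)
qed

text \<open>The limit \<open>K \<rightarrow> \<infinity>\<close> in \<open>tail_le_pow\<close>, with \<open>\<theta>\<close> fixed: \<open>\<beta>\<close> tends to \<open>1\<close>, and the power in the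
  denominator tends to an exponential.\<close>

lemma tail_le_exp:
  assumes \<theta>: "0 < \<theta>"
    and H: "AE \<omega> in M. H \<omega> = (1 / real N) \<cdot>\<^sub>m sum_mats n (\<lambda>l. G (Y l \<omega>)) N"
  shows "prob {\<omega> \<in> space M. lambda_min (H \<omega>) \<le> t}
       \<le> real n * exp (real N * (\<theta> * t - c / R * (1 - exp (- (\<theta> * R)))))"
proof -
  define K where "K k = real (2 * k + 1)" for k
  define \<beta> where "\<beta> k = 1 - \<theta> / K k * (real N * R)" for k
  define u where "u k = 1 - \<theta> / K k * (real N * t)" for k
  define x where "x = c / R * (1 - exp (- (\<theta> * R)))"
  have vanish: "(\<lambda>k. b / K k) \<longlonglongrightarrow> 0" for b
  proof -
    have "filterlim (\<lambda>k. K k) at_top sequentially"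
      unfolding K_def
      by (rule filterlim_compose[OF filterlim_real_sequentially])
        (auto intro!: filterlim_subseq simp: strict_mono_def)
    then show ?thesis by (intro tendsto_divide_0[OF tendsto_const] filterlim_at_top_imp_at_infinity)
  qed
  have \<beta>_lim: "\<beta> \<longlonglongrightarrow> 1" and u_lim: "u \<longlonglongrightarrow> 1"
    using tendsto_diff[OF tendsto_const[of 1] vanish[of "\<theta> * (real N * R)"]]
      tendsto_diff[OF tendsto_const[of 1] vanish[of "\<theta> * (real N * t)"]]
    by (simp_all add: \<beta>_def[abs_def] u_def[abs_def])
  have ev_\<beta>: "eventually (\<lambda>k. 0 < \<beta> k) sequentially" and ev_u: "eventually (\<lambda>k. 0 < u k) sequentially"
    using order_tendstoD(1)[OF \<beta>_lim, of 0] order_tendstoD(1)[OF u_lim, of 0] by simp_all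
  have pow_lim: "(\<lambda>k. u k ^ (2 * k)) \<longlonglongrightarrow> exp (- (\<theta> * (real N * t)))"
  proof -
    have "(\<lambda>k. (1 + (- (\<theta> * (real N * t))) / real (2 * k + 1)) ^ (2 * k + 1)) \<longlonglongrightarrow> exp (- (\<theta> * (real N * t)))"
      by (rule filterlim_compose[OF tendsto_exp_limit_sequentially])
        (auto intro!: filterlim_subseq simp: strict_mono_def)
    also have "(\<lambda>k. (1 + (- (\<theta> * (real N * t))) / real (2 * k + 1)) ^ (2 * k + 1)) = (\<lambda>k. u k ^ (2 * k + 1))"
      by (simp add: u_def K_def)
    \<comment> \<open>The exponent is \<open>K - 1\<close>, one less than in the classical limit; the missing factor tends to \<open>1\<close>.\<close>
    finally have "(\<lambda>k. u k ^ (2 * k + 1) / u k) \<longlonglongrightarrow> exp (- (\<theta> * (real N * t))) / 1"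
      using u_lim by (rule tendsto_divide) simp
    moreover have "eventually (\<lambda>k. u k ^ (2 * k + 1) / u k = u k ^ (2 * k)) sequentially"
      using ev_u by eventually_elim simp
    ultimately show ?thesis using tendsto_cong by force
  qed
  have "(\<lambda>k. real n * exp (- (real N * (\<beta> k * x))) / (\<beta> k * u k ^ (2 * k)))
      \<longlonglongrightarrow> real n * exp (- (real N * (1 * x))) / (1 * exp (- (\<theta> * (real N * t))))"
    by (intro tendsto_intros \<beta>_lim pow_lim) simp
  moreover have "eventually (\<lambda>k. prob {\<omega> \<in> space M. lambda_min (H \<omega>) \<le> t}
      \<le> real n * exp (- (real N * (\<beta> k * x))) / (\<beta> k * u k ^ (2 * k))) sequentially"
    using ev_\<beta> ev_u eventually_ge_at_top[of 1]
  proof eventually_elim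
    case (elim k)
    have "prob {\<omega> \<in> space M. lambda_min (H \<omega>) \<le> t}
       \<le> real n * exp (- (real N * (\<beta> k * (c / R) * (1 - exp (- (\<theta> * R))))))
           / (\<beta> k * (1 - \<theta> / real (2 * k + 1) * (real N * t)) ^ (2 * k))"
      using elim by (intro tail_le_pow \<theta> H) (auto simp: \<beta>_def u_def K_def)
    then show ?case by (simp add: x_def u_def K_def mult.assoc)
  qed
  ultimately have "prob {\<omega> \<in> space M. lambda_min (H \<omega>) \<le> t}
      \<le> real n * exp (- (real N * (1 * x))) / (1 * exp (- (\<theta> * (real N * t))))"
    by (intro tendsto_lowerbound[where F = sequentially]) auto
  also have "\<dots> = real n * exp (real N * (\<theta> * t - x))"
    by (simp add: exp_minus exp_diff algebra_simps divide_simps flip: exp_add)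
  finally show ?thesis by (simp add: x_def)
qed

text \<open>The exponent \<open>\<theta> (1 - \<epsilon>) c - (c / R) (1 - exp (- \<theta> R))\<close> is smallest where \<open>exp (- \<theta> R) = 1 - \<epsilon>\<close>.\<close>

theorem matrix_Chernoff_lower_tail:
  assumes \<epsilon>: "0 < \<epsilon>" "\<epsilon> < 1"
    and H: "AE \<omega> in M. H \<omega> = (1 / real N) \<cdot>\<^sub>m sum_mats n (\<lambda>l. G (Y l \<omega>)) N"
  shows "prob {\<omega> \<in> space M. lambda_min (H \<omega>) \<le> (1 - \<epsilon>) * c}
       \<le> real n * (exp (- \<epsilon>) / (1 - \<epsilon>) powr (1 - \<epsilon>)) powr (c * real N / R)"
proof -
  define \<theta> where "\<theta> = - ln (1 - \<epsilon>) / R"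
  have \<theta>: "0 < \<theta>" using \<epsilon> R_pos by (simp add: \<theta>_def divide_neg_pos)
  have "exp (- (\<theta> * R)) = 1 - \<epsilon>" using \<epsilon> R_pos by (simp add: \<theta>_def)
  then have "prob {\<omega> \<in> space M. lambda_min (H \<omega>) \<le> (1 - \<epsilon>) * c}
      \<le> real n * exp (real N * (\<theta> * ((1 - \<epsilon>) * c) - c / R * \<epsilon>))"
    using tail_le_exp[OF \<theta> H, of "(1 - \<epsilon>) * c"] by simp
  also have "real N * (\<theta> * ((1 - \<epsilon>) * c) - c / R * \<epsilon>)
      = c * real N / R * ln (exp (- \<epsilon>) / (1 - \<epsilon>) powr (1 - \<epsilon>))"
    using \<epsilon> R_pos by (simp add: \<theta>_def ln_div ln_powr field_simps)
  also have "exp \<dots> = (exp (- \<epsilon>) / (1 - \<epsilon>) powr (1 - \<epsilon>)) powr (c * real N / R)"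
    using \<epsilon> by (simp add: powr_def)
  finally show ?thesis .
qed

end

section \<open>Interaction maps and their Gram matrices\<close>

text \<open>Only the particles \<open>1, ..., N\<close> and the values of the kernel at their mutual distances enter.  This
  lets a configuration be restricted to its index set and a kernel be changed off the distances that
  occur.\<close>

lemma interaction_cong:
  assumes "i \<in> {1..N}" "\<And>j. j \<in> {1..N} \<Longrightarrow> x j = y j"
    and "\<And>j. j \<in> {1..N} - {i} \<Longrightarrow> \<phi> (norm (x i - x j)) = \<phi>' (norm (x i - x j))"
  shows "interaction N \<phi> x i = interaction N \<phi>' y i"
  using assms unfolding interaction_def by (auto intro!: sum.cong arg_cong2[where f = scaleR])

lemma interaction_linear_comb:
  "interaction N (\<lambda>r. \<Sum>k\<in>I. a k * u k r) x i = (\<Sum>k\<in>I. a k *\<^sub>R interaction N (u k) x i)"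
proof -
  define e where "e j = (x i - x j) /\<^sub>R norm (x i - x j)" for j
  have "(\<Sum>j\<in>{1..N} - {i}. (\<Sum>k\<in>I. a k * u k (norm (x i - x j))) *\<^sub>R e j)
      = (\<Sum>k\<in>I. \<Sum>j\<in>{1..N} - {i}. (a k * u k (norm (x i - x j))) *\<^sub>R e j)"
    unfolding scaleR_sum_left by (rule sum.swap)
  then show ?thesis
    unfolding interaction_def e_def[symmetric] by (simp add: scaleR_sum_right mult_ac)
qed

lemma norm_interaction_le:
  assumes N: "2 \<le> N" and i: "i \<in> {1..N}" and b: "\<And>r. \<bar>\<phi> r\<bar> \<le> b"
  shows "norm (interaction N \<phi> x i) \<le> b"
proof -
  have b0: "0 \<le> b" using b[of 0] by simp
  have "norm (\<Sum>j\<in>{1..N} - {i}. \<phi> (norm (x i - x j)) *\<^sub>R ((x i - x j) /\<^sub>R norm (x i - x j)))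
      \<le> (\<Sum>j\<in>{1..N} - {i}. b)"
  proof (intro sum_norm_le)
    fix j
    have "norm ((x i - x j) /\<^sub>R norm (x i - x j)) \<le> 1"
      by (cases "x i = x j") auto
    then have "\<bar>\<phi> (norm (x i - x j))\<bar> * norm ((x i - x j) /\<^sub>R norm (x i - x j)) \<le> b * 1"
      using b b0 by (intro mult_mono) auto
    then show "norm (\<phi> (norm (x i - x j)) *\<^sub>R ((x i - x j) /\<^sub>R norm (x i - x j))) \<le> b"
      by (simp only: norm_scaleR mult_1_right)
  qed
  also have "\<dots> = (real N - 1) * b" using i N by (simp add: of_nat_diff)
  finally show ?thesis
    using N unfolding interaction_def by (simp add: pos_divide_le_eq mult.commute)
qed

lemma measurable_interaction:
  assumes [measurable]: "\<phi> \<in> borel_measurable borel" and i: "i \<in> {1..N}"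
  shows "(\<lambda>x :: nat \<Rightarrow> 'e::euclidean_space. interaction N \<phi> x i) \<in> borel_measurable (config_space N)"
proof -
  have [measurable]: "(\<lambda>x :: nat \<Rightarrow> 'e. x i) \<in> borel_measurable (config_space N)"
    using i by (rule measurable_component_singleton)
  have [measurable]: "(\<lambda>x :: nat \<Rightarrow> 'e. x j) \<in> borel_measurable (config_space N)" if "j \<in> {1..N} - {i}" for j
    using that by (intro measurable_component_singleton) auto
  show ?thesis unfolding interaction_def by measurable
qed

text \<open>The contribution of one sample to the normal matrix, for arbitrary kernels \<open>u\<close> in place of the
  extended basis functions.\<close>

definition gram_matrix ::
    "nat \<Rightarrow> nat \<Rightarrow> (nat \<Rightarrow> real \<Rightarrow> real) \<Rightarrow> (nat \<Rightarrow> 'e::euclidean_space) \<Rightarrow> real mat" where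
  "gram_matrix N n u x = mat n n (\<lambda>(k, l). 1 / real N *
     (\<Sum>i=1..N. inner (interaction N (u k) x i) (interaction N (u l) x i)))"

lemma gram_matrix_sym: "gram_matrix N n u x \<in> sym_mats n"
  by (intro sym_matsI) (auto simp: gram_matrix_def inner_commute intro!: eq_matI)

text \<open>The form is a sum of squares because the interaction depends linearly on the kernel.\<close>

lemma gram_matrix_quad:
  assumes v: "v \<in> carrier_vec n"
  shows "v \<bullet> (gram_matrix N n u x *\<^sub>v v)
    = 1 / real N * (\<Sum>i=1..N. (norm (interaction N (\<lambda>r. \<Sum>k<n. v $ k * u k r) x i))\<^sup>2)"
proof -
  define w where "w k i = interaction N (u k) x i" for k i
  have "v \<bullet> (gram_matrix N n u x *\<^sub>v v)
      = (\<Sum>k<n. \<Sum>l<n. v $ k * ((1 / real N * (\<Sum>i=1..N. inner (w k i) (w l i))) * v $ l))"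
    using v by (auto simp: scalar_prod_def gram_matrix_def w_def atLeast0LessThan sum_distrib_left
        intro!: sum.cong)
  also have "\<dots> = 1 / real N * (\<Sum>k<n. \<Sum>l<n. \<Sum>i=1..N. v $ k * v $ l * inner (w k i) (w l i))"
    by (simp add: sum_distrib_left sum_distrib_right mult_ac)
  also have "\<dots> = 1 / real N * (\<Sum>i=1..N. \<Sum>k<n. \<Sum>l<n. v $ k * v $ l * inner (w k i) (w l i))"
    by (subst (2) sum.swap, subst sum.swap) (rule refl)
  also have "\<dots> = 1 / real N * (\<Sum>i=1..N. (norm (\<Sum>k<n. v $ k *\<^sub>R w k i))\<^sup>2)"
    unfolding power2_norm_eq_inner inner_sum_left inner_sum_right
    by (simp add: mult_ac inner_commute)
  finally show ?thesis by (simp add: interaction_linear_comb w_def)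
qed

lemma gram_matrix_psd: "loewner_le n (0\<^sub>m n n) (gram_matrix N n u x)"
  unfolding psd_iff by (auto simp: gram_matrix_quad intro!: divide_nonneg_nonneg sum_nonneg)

text \<open>A combination of the kernels with coefficients \<open>v\<close> is bounded by \<open>b (\<Sum>\<^sub>k \<bar>v\<^sub>k\<bar>)\<close>, whose square is at most
  \<open>n b\<^sup>2 \<bar>v\<bar>\<^sup>2\<close>; the interaction obeys the same bound as its kernel.\<close>

lemma gram_matrix_le:
  assumes N: "2 \<le> N" and b: "\<And>k r. \<bar>u k r\<bar> \<le> b"
  shows "loewner_le n (gram_matrix N n u x) ((real n * b\<^sup>2) \<cdot>\<^sub>m 1\<^sub>m n)"
  unfolding loewner_le_def
proof
  fix v :: "real vec" assume v: "v \<in> carrier_vec n"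
  have b0: "0 \<le> b" using b[of 0 0] by simp
  define s where "s = (\<Sum>k<n. \<bar>v $ k\<bar>)"
  have s2: "s\<^sup>2 \<le> real n * (v \<bullet> v)"
    using Cauchy_Schwarz_ineq_sum[of "\<lambda>_. 1" "\<lambda>k. \<bar>v $ k\<bar>" "{..<n}"] v
    by (simp add: s_def scalar_prod_def power2_eq_square atLeast0LessThan)
  have "\<bar>\<Sum>k<n. v $ k * u k r\<bar> \<le> s * b" for r
  proof -
    have "\<bar>\<Sum>k<n. v $ k * u k r\<bar> \<le> (\<Sum>k<n. \<bar>v $ k * u k r\<bar>)" by (rule sum_abs)
    also have "\<dots> \<le> (\<Sum>k<n. \<bar>v $ k\<bar> * b)" using b by (intro sum_mono) (auto simp: abs_mult mult_left_mono)
    finally show ?thesis by (simp add: s_def sum_distrib_right)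
  qed
  then have le: "(norm (interaction N (\<lambda>r. \<Sum>k<n. v $ k * u k r) x i))\<^sup>2 \<le> (s * b)\<^sup>2"
    if "i \<in> {1..N}" for i
    using norm_interaction_le[OF N that, of "\<lambda>r. \<Sum>k<n. v $ k * u k r" "s * b" x] by (intro power_mono) auto
  have "v \<bullet> (gram_matrix N n u x *\<^sub>v v) \<le> 1 / real N * (\<Sum>i=1..N. (s * b)\<^sup>2)"
    unfolding gram_matrix_quad[OF v] using le by (intro mult_left_mono sum_mono) auto
  also have "\<dots> = s\<^sup>2 * b\<^sup>2" using N by (simp add: power_mult_distrib)
  also have "\<dots> \<le> (real n * (v \<bullet> v)) * b\<^sup>2" using s2 by (rule mult_right_mono) simp
  finally show "v \<bullet> (gram_matrix N n u x *\<^sub>v v) \<le> v \<bullet> (((real n * b\<^sup>2) \<cdot>\<^sub>m 1\<^sub>m n) *\<^sub>v v)"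
    using v by (simp add: scaled_one_mult_vec[of _ n] mult_ac)
qed

lemma gram_matrix_measurable:
  assumes "\<And>k. k < n \<Longrightarrow> u k \<in> borel_measurable borel" and "k < n" "l < n"
  shows "(\<lambda>x :: nat \<Rightarrow> 'e::euclidean_space. gram_matrix N n u x $$ (k, l)) \<in> borel_measurable (config_space N)"
proof -
  have "(\<lambda>x :: nat \<Rightarrow> 'e. 1 / real N * (\<Sum>i=1..N. inner (interaction N (u k) x i) (interaction N (u l) x i)))
      \<in> borel_measurable (config_space N)"
    using assms
    by (intro borel_measurable_times borel_measurable_const borel_measurable_sum
        borel_measurable_inner measurable_interaction) auto
  then show ?thesis using assms(2,3) by (simp add: gram_matrix_def)
qed

lemma normal_matrix_eq_average:
  "normal_matrix N M n \<psi> (\<lambda>m i. Xs m i \<omega>)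
    = (1 / real M) \<cdot>\<^sub>m sum_mats n (\<lambda>m. gram_matrix N n (\<lambda>k. zero_ext (\<psi> (Suc k))) (joint N (Xs m) \<omega>)) M"
proof -
  have eq: "interaction N \<phi> (joint N (Xs m) \<omega>) i = interaction N \<phi> (\<lambda>i. Xs m i \<omega>) i"
    if "i \<in> {1..N}" for \<phi> m i
    using that by (intro interaction_cong) (auto simp: joint_def)
  show ?thesis
    by (intro eq_matI)
      (auto simp: normal_matrix_def sum_mats_def gram_matrix_def eq sum_distrib_left mult_ac
        intro!: sum.cong)
qed

section \<open>Laws of pairwise distances\<close>

text \<open>First exchange \<open>a\<close> with \<open>i\<close>, then exchange the new image of \<open>b\<close> with \<open>j\<close>; the second transposition
  leaves \<open>i\<close> alone.\<close>

lemma permutes_with_two_values: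
  assumes "a \<in> S" "b \<in> S" "a \<noteq> b" "i \<in> S" "j \<in> S" "i \<noteq> j"
  obtains \<pi> where "\<pi> permutes S" "\<pi> a = i" "\<pi> b = j"
proof -
  define \<tau> where "\<tau> = Transposition.transpose a i"
  define \<pi> where "\<pi> = Transposition.transpose (\<tau> b) j \<circ> \<tau>"
  have \<tau>: "\<tau> permutes S" unfolding \<tau>_def using assms by (intro permutes_swap_id)
  have \<tau>b: "\<tau> b \<in> S" using permutes_in_image[OF \<tau>] assms by simp
  have \<tau>a: "\<tau> a = i" by (simp add: \<tau>_def)
  have "\<tau> b \<noteq> i" using \<tau>a assms(3) permutes_inj[OF \<tau>] by (metis injD)
  then have "\<pi> a = i" "\<pi> b = j" using \<tau>a assms(6) by (auto simp: \<pi>_def transpose_apply_other)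
  moreover have "\<pi> permutes S"
    unfolding \<pi>_def using \<tau> \<tau>b assms by (intro permutes_compose permutes_swap_id)
  ultimately show thesis by (rule that[rotated 1])
qed

lemma measurable_joint:
  assumes "exchangeable P N X"
  shows "joint N X \<in> measurable P (config_space N)"
  using assms unfolding joint_def[abs_def] exchangeable_def by (intro measurable_restrict) auto

text \<open>A permutation that takes the labels \<open>1, 2\<close> to \<open>i, j\<close> does not change the joint law.\<close>

lemma exchangeable_distance_law:
  fixes X :: "nat \<Rightarrow> 'a \<Rightarrow> 'e::euclidean_space"
  assumes ex: "exchangeable P N X" and N: "2 \<le> N" and ij: "i \<in> {1..N}" "j \<in> {1..N}" "i \<noteq> j"
  shows "distr (distr P (config_space N) (joint N X)) borel (\<lambda>x. norm (x i - x j))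
    = exploration_measure P X"
proof -
  have dist_meas: "(\<lambda>x. norm (x a - x b)) \<in> borel_measurable (config_space N)"
    if "a \<in> {1..N}" "b \<in> {1..N}" for a b
  proof -
    have [measurable]: "(\<lambda>x. x a) \<in> borel_measurable (config_space N)"
      "(\<lambda>x. x b) \<in> borel_measurable (config_space N)"
      using that by (auto intro: measurable_component_singleton)
    show ?thesis by measurable
  qed
  obtain \<pi> where \<pi>: "\<pi> permutes {1..N}" "\<pi> 1 = i" "\<pi> 2 = j"
    using permutes_with_two_values[of 1 "{1..N}" 2 i j] N ij by auto
  then have \<pi>1: "\<pi> (Suc 0) = i" by simp
  have X\<pi>: "joint N (\<lambda>i. X (\<pi> i)) \<in> measurable P (config_space N)"
    unfolding joint_def[abs_def] using ex permutes_in_image[OF \<pi>(1)]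
    by (intro measurable_restrict) (auto simp: exchangeable_def)
  have "exploration_measure P X
      = distr (distr P (config_space N) (joint N X)) borel (\<lambda>x. norm (x 1 - x 2))"
    using N by (subst distr_distr[OF dist_meas measurable_joint[OF ex]])
      (auto simp: exploration_measure_def joint_def comp_def)
  also have "distr P (config_space N) (joint N X) = distr P (config_space N) (joint N (\<lambda>i. X (\<pi> i)))"
    using ex \<pi>(1) by (simp add: exchangeable_def)
  also have "distr \<dots> borel (\<lambda>x. norm (x 1 - x 2)) = distr P borel (\<lambda>\<omega>. norm (X i \<omega> - X j \<omega>))"
    using N by (subst distr_distr[OF dist_meas X\<pi>]) (auto simp: joint_def comp_def \<pi>1 \<pi>(3))
  also have "\<dots> = distr (distr P (config_space N) (joint N X)) borel (\<lambda>x. norm (x i - x j))"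
    using ij by (subst distr_distr[OF dist_meas measurable_joint[OF ex]]) (auto simp: joint_def comp_def)
  finally show ?thesis by (rule sym)
qed

section \<open>The basis functions on the unit interval\<close>

text \<open>The basis functions are bounded by \<open>C_max\<close> only almost everywhere.  Replacing larger values by zero
  gives bounds at every point and alters the kernels on a null set.\<close>

definition cut_above :: "real \<Rightarrow> (real \<Rightarrow> real) \<Rightarrow> real \<Rightarrow> real" where
  "cut_above b f r = (if \<bar>f r\<bar> \<le> b then f r else 0)"

lemma measurable_zero_ext:
  assumes "sets \<rho> = sets borel" "f \<in> borel_measurable (on_unit \<rho>)"
  shows "zero_ext f \<in> borel_measurable borel"
proof -
  have "{0..1} \<inter> space \<rho> \<in> sets \<rho>"
    using assms(1) sets_eq_imp_space_eq[OF assms(1)] by simp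
  then have "(\<lambda>r. if r \<in> {0..1} then f r else 0) \<in> borel_measurable \<rho>"
    using assms(2) by (subst (asm) measurable_restrict_space_iff[where c = 0]) auto
  then show ?thesis
    unfolding zero_ext_def[abs_def] measurable_cong_sets[OF assms(1) refl] .
qed

lemma measurable_cut_above:
  assumes [measurable]: "f \<in> borel_measurable borel"
  shows "cut_above b f \<in> borel_measurable borel"
  unfolding cut_above_def[abs_def] by measurable

lemma AE_Linf_norm_le:
  assumes C: "(SUP k\<in>{1..}. Linf_norm \<rho> (\<psi> k)) = ereal C" and k: "1 \<le> k"
  shows "AE r in on_unit \<rho>. \<bar>\<psi> k r\<bar> \<le> C"
proof -
  have "Linf_norm \<rho> (\<psi> k) \<le> ereal C"
    unfolding C[symmetric] using k by (intro SUP_upper) simp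
  moreover have "AE r in on_unit \<rho>. ereal \<bar>\<psi> k r\<bar> \<le> Linf_norm \<rho> (\<psi> k)"
    unfolding Linf_norm_def by (rule esssup_AE)
  ultimately show ?thesis by (auto elim!: eventually_mono intro: order_trans simp flip: ereal_less_eq(3))
qed

text \<open>Otherwise \<open>\<psi>\<^sub>1\<close> vanishes almost everywhere and cannot have norm one.\<close>

lemma sup_norm_pos:
  assumes C: "(SUP k\<in>{1..}. Linf_norm \<rho> (\<psi> k)) = ereal C"
    and basis: "orthonormal_basis \<rho> \<psi>"
  shows "0 < C"
proof (rule ccontr)
  assume "\<not> 0 < C"
  then have "AE r in on_unit \<rho>. \<psi> 1 r * \<psi> 1 r = 0"
    using AE_Linf_norm_le[OF C, of 1] by (auto elim!: eventually_mono)
  then have "L2_inner \<rho> (\<psi> 1) (\<psi> 1) = 0"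
    unfolding L2_inner_def by (rule integral_eq_zero_AE)
  moreover have "L2_inner \<rho> (\<psi> 1) (\<psi> 1) = 1"
    using basis by (simp add: orthonormal_basis_def)
  ultimately show False by simp
qed

lemma AE_zero_ext_le:
  assumes \<rho>: "sets \<rho> = sets borel" and C: "(SUP k\<in>{1..}. Linf_norm \<rho> (\<psi> k)) = ereal C"
    and k: "1 \<le> k" and C0: "0 \<le> C"
  shows "AE r in \<rho>. \<bar>zero_ext (\<psi> k) r\<bar> \<le> C"
proof -
  have "{0..1} \<inter> space \<rho> \<in> sets \<rho>"
    using \<rho> sets_eq_imp_space_eq[OF \<rho>] by simp
  then have "AE r in \<rho>. r \<in> {0..1} \<longrightarrow> \<bar>\<psi> k r\<bar> \<le> C"
    using AE_Linf_norm_le[OF C k] by (simp only: AE_restrict_space_iff)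
  then show ?thesis by eventually_elim (use C0 in \<open>auto simp: zero_ext_def\<close>)
qed

text \<open>This is Parseval's identity for finite combinations.  The shift of the index reconciles the basis,
  counted from \<open>1\<close>, with vectors, counted from \<open>0\<close>.\<close>

lemma L2_linear_comb:
  fixes a :: "nat \<Rightarrow> real" and n :: nat
  assumes basis: "orthonormal_basis \<rho> \<psi>"
  defines "\<phi> \<equiv> \<lambda>r. \<Sum>k<n. a k * \<psi> (Suc k) r"
  shows "\<phi> \<in> L2_space \<rho>" and "(L2_norm \<rho> (\<phi>))\<^sup>2 = (\<Sum>k<n. (a k)\<^sup>2)"
proof -
  have meas [measurable]: "\<psi> (Suc k) \<in> borel_measurable (on_unit \<rho>)"
    and sq: "integrable (on_unit \<rho>) (\<lambda>r. (\<psi> (Suc k) r)\<^sup>2)" for k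
    using basis by (auto simp: orthonormal_basis_def L2_space_def)
  have int: "integrable (on_unit \<rho>) (\<lambda>r. \<psi> (Suc k) r * \<psi> (Suc l) r)" for k l
  proof (rule Bochner_Integration.integrable_bound[OF Bochner_Integration.integrable_add[OF sq[of k] sq[of l]]])
    have "\<bar>x * y\<bar> \<le> x\<^sup>2 + y\<^sup>2" for x y :: real
    proof -
      have "2 * (\<bar>x\<bar> * \<bar>y\<bar>) \<le> x\<^sup>2 + y\<^sup>2" using sum_squares_bound[of "\<bar>x\<bar>" "\<bar>y\<bar>"] by simp
      moreover have "0 \<le> \<bar>x\<bar> * \<bar>y\<bar>" by simp
      ultimately show ?thesis unfolding abs_mult by linarith
    qed
    then show "AE r in on_unit \<rho>. norm (\<psi> (Suc k) r * \<psi> (Suc l) r) \<le> norm ((\<psi> (Suc k) r)\<^sup>2 + (\<psi> (Suc l) r)\<^sup>2)"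
      by simp
  qed measurable
  have \<phi>2: "\<phi> r * \<phi> r = (\<Sum>k<n. \<Sum>l<n. (a k * a l) * (\<psi> (Suc k) r * \<psi> (Suc l) r))" for r
    by (simp add: \<phi>_def sum_product mult_ac)
  have "integrable (on_unit \<rho>) (\<lambda>r. \<phi> r * \<phi> r)"
    unfolding \<phi>2 using int by (intro Bochner_Integration.integrable_sum integrable_mult_right)
  moreover have "\<phi> \<in> borel_measurable (on_unit \<rho>)"
    unfolding \<phi>_def by measurable
  ultimately show "\<phi> \<in> L2_space \<rho>"
    by (simp add: L2_space_def power2_eq_square)
  have "L2_inner \<rho> (\<phi>) (\<phi>) = (\<Sum>k<n. \<Sum>l<n. (a k * a l) * L2_inner \<rho> (\<psi> (Suc k)) (\<psi> (Suc l)))"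
    unfolding L2_inner_def \<phi>2 using int by simp
  also have "\<dots> = (\<Sum>k<n. \<Sum>l<n. if l = k then a k * a l else 0)"
    using basis by (intro sum.cong refl) (auto simp: orthonormal_basis_def)
  also have "\<dots> = (\<Sum>k<n. (a k)\<^sup>2)"
    by (simp add: power2_eq_square)
  finally show "(L2_norm \<rho> (\<phi>))\<^sup>2 = (\<Sum>k<n. (a k)\<^sup>2)"
    by (simp add: L2_norm_def sum_nonneg)
qed

section \<open>The smallest eigenvalue of the normal matrix\<close>

theorem lemma3p14:
  fixes P :: "'a measure"
    and N M n :: nat
    and X :: "nat \<Rightarrow> 'a \<Rightarrow> real ^ 'd"
    and Xs :: "nat \<Rightarrow> nat \<Rightarrow> 'a \<Rightarrow> real ^ 'd"
    and \<rho> :: "real measure"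
    and \<psi> :: "nat \<Rightarrow> real \<Rightarrow> real"
    and L :: "(real \<Rightarrow> real) \<Rightarrow> real \<Rightarrow> real"
    and c C_max :: real
  assumes "prob_space P"
    and "3 \<le> N" and "1 \<le> M" and "1 \<le> n"
    and "admissible P N X"
    and "iid_copies P N X M Xs"
    and "\<rho> = exploration_measure P X"
    and "exploration_regular P X"
    and "orthonormal_basis \<rho> \<psi>"
    and "(SUP k\<in>{1..}. Linf_norm \<rho> (\<psi> k)) = ereal C_max"
    and "normal_operator P N X L"
    and "coercive \<rho> L c"
  shows "(\<forall>\<epsilon>::real. 0 < \<epsilon> \<and> \<epsilon> < 1 \<longrightarrow>
            measure P {\<omega> \<in> space P.
              lambda_min (normal_matrix N M n \<psi> (\<lambda>m i. Xs m i \<omega>)) \<le> (1 - \<epsilon>) * c}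
            \<le> real n * (exp (- \<epsilon>) / (1 - \<epsilon>) powr (1 - \<epsilon>))
                         powr (c * real M / (real n * C_max\<^sup>2)))
       \<and> measure P {\<omega> \<in> space P.
            lambda_min (normal_matrix N M n \<psi> (\<lambda>m i. Xs m i \<omega>)) \<le> c / 2}
          \<le> real n * (exp 1 / 2) powr (- (c * real M / (2 * real n * C_max\<^sup>2)))"
proof -
  interpret prob_space P by fact
  have N: "2 \<le> N" "0 < N" using assms(2) by auto
  have ex: "exchangeable P N X" using assms(5) by (simp add: admissible_def)
  have \<rho>: "\<rho> = exploration_measure P X" by fact
  have sets_\<rho>: "sets \<rho> = sets borel" by (simp add: \<rho> exploration_measure_def)
  have C: "0 < C_max" by (rule sup_norm_pos[OF assms(10,9)])
  define \<mu> where "\<mu> = distr P (config_space N) (joint N X)"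
  have sets_\<mu>: "sets \<mu> = sets (config_space N)" by (simp add: \<mu>_def)
  have Xm: "joint N X \<in> measurable P (config_space N)" using ex by (rule measurable_joint)
  have indep: "indep_vars (\<lambda>_. config_space N) (\<lambda>m. joint N (Xs m)) {1..M}"
    and law: "m \<in> {1..M} \<Longrightarrow> distr P (config_space N) (joint N (Xs m)) = \<mu>" for m
    using assms(6) by (auto simp: iid_copies_def \<mu>_def)
  have Xsm: "joint N (Xs m) \<in> measurable P (config_space N)" if "m \<in> {1..M}" for m
    using indep that by (simp add: indep_vars_def)

  \<comment> \<open>The basis functions as they enter the interaction, and their versions bounded everywhere.\<close>
  define z where "z k = zero_ext (\<psi> (Suc k))" for k
  define u where "u k = cut_above C_max (z k)" for k
  have z_meas [measurable]: "z k \<in> borel_measurable borel" for k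
    using assms(9) unfolding z_def
    by (intro measurable_zero_ext[OF sets_\<rho>]) (auto simp: orthonormal_basis_def L2_space_def)
  have u_meas [measurable]: "u k \<in> borel_measurable borel" for k
    unfolding u_def by (intro measurable_cut_above z_meas)
  have u_le: "\<bar>u k r\<bar> \<le> C_max" for k r
    using C by (simp add: u_def cut_above_def)

  \<comment> \<open>Configurations in which no mutual distance meets the exceptional null sets.  All statements about them are made for the common law \<open>\<mu>\<close> of the samples and transferred from there.\<close>
  define good where "good x \<longleftrightarrow>
    (\<forall>i\<in>{1..N}. \<forall>j\<in>{1..N} - {i}. \<forall>k<n. u k (norm (x i - x j)) = z k (norm (x i - x j)))"
    for x :: "nat \<Rightarrow> real ^ 'd"
  have good: "AE x in \<mu>. good x"
  proof -
    have "AE x in \<mu>. u k (norm (x i - x j)) = z k (norm (x i - x j))"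
      if ij: "i \<in> {1..N}" "j \<in> {1..N} - {i}" for i j k
    proof -
      have [measurable]: "(\<lambda>x. x i) \<in> borel_measurable (config_space N)"
        "(\<lambda>x. x j) \<in> borel_measurable (config_space N)"
        using ij by (auto intro: measurable_component_singleton)
      have "(\<lambda>x. norm (x i - x j)) \<in> borel_measurable (config_space N)" by measurable
      then have meas: "(\<lambda>x. norm (x i - x j)) \<in> borel_measurable \<mu>"
        unfolding measurable_cong_sets[OF sets_\<mu> refl] .
      have "AE r in \<rho>. u k r = z k r"
        using AE_zero_ext_le[OF sets_\<rho> assms(10), of "Suc k"] C
        by (auto simp: u_def z_def cut_above_def elim!: eventually_mono)
      also have "\<rho> = distr \<mu> borel (\<lambda>x. norm (x i - x j))"
        unfolding \<rho> \<mu>_def using ij by (intro exchangeable_distance_law[symmetric] ex N) auto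
      finally show ?thesis by (rule AE_distrD[OF meas])
    qed
    then have "AE x in \<mu>. \<forall>i\<in>{1..N}. \<forall>j\<in>{1..N} - {i}. \<forall>k\<in>{..<n}.
        u k (norm (x i - x j)) = z k (norm (x i - x j))"
      by (intro AE_finite_allI) auto
    then show ?thesis unfolding good_def by eventually_elim auto
  qed

  have H: "AE \<omega> in P. normal_matrix N M n \<psi> (\<lambda>m i. Xs m i \<omega>)
      = (1 / real M) \<cdot>\<^sub>m sum_mats n (\<lambda>m. gram_matrix N n u (joint N (Xs m) \<omega>)) M"
  proof -
    have "AE \<omega> in P. good (joint N (Xs m) \<omega>)" if "m \<in> {1..M}" for m
    proof (rule AE_distrD[OF Xsm[OF that]])
      show "AE x in distr P (config_space N) (joint N (Xs m)). good x"
        unfolding law[OF that] by (rule good)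
    qed
    then have "AE \<omega> in P. \<forall>m\<in>{1..M}. good (joint N (Xs m) \<omega>)"
      by (intro AE_finite_allI) auto
    then show ?thesis
    proof eventually_elim
      case (elim \<omega>)
      have "interaction N (z k) (joint N (Xs m) \<omega>) i = interaction N (u k) (joint N (Xs m) \<omega>) i"
        if "m \<in> {1..M}" "i \<in> {1..N}" "k < n" for m i k
        using elim that by (intro interaction_cong) (auto simp: good_def)
      then show ?case
        unfolding normal_matrix_eq_average z_def[symmetric]
        by (intro arg_cong2[where f = smult_mat] refl eq_matI)
          (auto simp: sum_mats_def gram_matrix_def intro!: sum.cong)
    qed
  qed

  have mean: "c * (v \<bullet> v) \<le> expectation (\<lambda>\<omega>. v \<bullet> (gram_matrix N n u (joint N (Xs m) \<omega>) *\<^sub>v v))"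
    if m: "m \<in> {1..M}" and v: "v \<in> carrier_vec n" for m v
  proof -
    \<comment> \<open>Coercivity speaks about \<open>\<phi>\<close>, the Gram matrix of the bounded kernels about \<open>\<phi>u\<close>; both give the same interaction for almost every configuration.\<close>
    define \<phi> where "\<phi> = (\<lambda>r. \<Sum>k<n. v $ k * \<psi> (Suc k) r)"
    define \<phi>u where "\<phi>u = (\<lambda>r. \<Sum>k<n. v $ k * u k r)"
    have \<phi>z: "zero_ext \<phi> = (\<lambda>r. \<Sum>k<n. v $ k * z k r)"
    proof
      fix r show "zero_ext \<phi> r = (\<Sum>k<n. v $ k * z k r)"
        by (cases "r \<in> {0..1}") (simp_all only: zero_ext_def \<phi>_def z_def if_True if_False
            mult_zero_right sum.neutral_const)
    qed
    have \<phi>: "\<phi> \<in> L2_space \<rho>" "(L2_norm \<rho> \<phi>)\<^sup>2 = v \<bullet> v"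
      using L2_linear_comb[OF assms(9), where n = n and a = "\<lambda>k. v $ k"] v
      by (simp_all add: \<phi>_def scalar_prod_def power2_eq_square atLeast0LessThan)
    have \<phi>u_meas [measurable]: "\<phi>u \<in> borel_measurable borel" unfolding \<phi>u_def by measurable
    have \<phi>z_meas [measurable]: "zero_ext \<phi> \<in> borel_measurable borel" unfolding \<phi>z by measurable
    define b where "b = (\<Sum>k<n. \<bar>v $ k\<bar> * C_max)"
    have \<phi>u_le: "\<bar>\<phi>u r\<bar> \<le> b" for r
      unfolding \<phi>u_def b_def using u_le
      by (intro order_trans[OF sum_abs] sum_mono) (auto simp: abs_mult mult_left_mono)
    define q where "q x i = (norm (interaction N \<phi>u x i))\<^sup>2" for x :: "nat \<Rightarrow> real ^ 'd" and i
    have q_meas: "(\<lambda>x. q x i) \<in> borel_measurable (config_space N)" if "i \<in> {1..N}" for i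
      using measurable_interaction[OF \<phi>u_meas that, where 'e = "real ^ 'd"] unfolding q_def by measurable
    have q_meas\<mu>: "(\<lambda>x. q x i) \<in> borel_measurable \<mu>" if "i \<in> {1..N}" for i
      using q_meas[OF that] unfolding measurable_cong_sets[OF sets_\<mu> refl] .
    have prob_\<mu>: "prob_space \<mu>" unfolding \<mu>_def by (rule prob_space_distr[OF Xm])
    interpret \<mu>: prob_space \<mu> by (rule prob_\<mu>)
    have q_int: "integrable \<mu> (\<lambda>x. q x i)" if "i \<in> {1..N}" for i
    proof (rule \<mu>.integrable_const_bound[where B = "b\<^sup>2"])
      show "AE x in \<mu>. norm (q x i) \<le> b\<^sup>2"
        using norm_interaction_le[OF N(1) that \<phi>u_le] by (intro AE_I2) (auto simp: q_def intro!: power_mono)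
    qed (rule q_meas\<mu>[OF that])
    have law_i: "(LINT x|\<mu>. q x i) = (LINT \<omega>|P. inner
        (interaction N (zero_ext \<phi>) (\<lambda>i. X i \<omega>) i) (interaction N (zero_ext \<phi>) (\<lambda>i. X i \<omega>) i))"
      if i: "i \<in> {1..N}" for i
    proof -
      define qz where "qz x = (norm (interaction N (zero_ext \<phi>) x i))\<^sup>2" for x :: "nat \<Rightarrow> real ^ 'd"
      have qz_meas: "qz \<in> borel_measurable (config_space N)"
        using measurable_interaction[OF \<phi>z_meas i, where 'e = "real ^ 'd"] unfolding qz_def by measurable
      have "(LINT x|\<mu>. q x i) = (LINT x|\<mu>. qz x)"
      proof (rule integral_cong_AE)
        show "AE x in \<mu>. q x i = qz x"
          using good
        proof eventually_elim
          case (elim x)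
          have "interaction N \<phi>u x i = interaction N (zero_ext \<phi>) x i"
            using elim i by (intro interaction_cong) (auto simp: \<phi>u_def \<phi>z good_def)
          then show ?case by (simp add: q_def qz_def)
        qed
      qed (use q_meas\<mu>[OF i] qz_meas in \<open>auto simp: measurable_cong_sets[OF sets_\<mu> refl]\<close>)
      also have "\<dots> = (LINT \<omega>|P. qz (joint N X \<omega>))"
        unfolding \<mu>_def by (rule integral_distr[OF Xm qz_meas])
      also have "\<dots> = (LINT \<omega>|P. inner
        (interaction N (zero_ext \<phi>) (\<lambda>i. X i \<omega>) i) (interaction N (zero_ext \<phi>) (\<lambda>i. X i \<omega>) i))"
      proof (intro Bochner_Integration.integral_cong refl)
        fix \<omega>
        have "interaction N (zero_ext \<phi>) (joint N X \<omega>) i = interaction N (zero_ext \<phi>) (\<lambda>i. X i \<omega>) i"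
          using i by (intro interaction_cong) (auto simp: joint_def)
        then show "qz (joint N X \<omega>) = inner
            (interaction N (zero_ext \<phi>) (\<lambda>i. X i \<omega>) i) (interaction N (zero_ext \<phi>) (\<lambda>i. X i \<omega>) i)"
          by (simp add: qz_def power2_norm_eq_inner)
      qed
      finally show ?thesis .
    qed
    have "c * (v \<bullet> v) \<le> L2_inner \<rho> (L \<phi>) \<phi>"
      using assms(12) \<phi> by (auto simp: coercive_def)
    also have "\<dots> = 1 / real N * (\<Sum>i=1..N. LINT \<omega>|P. inner
        (interaction N (zero_ext \<phi>) (\<lambda>i. X i \<omega>) i) (interaction N (zero_ext \<phi>) (\<lambda>i. X i \<omega>) i))"
      using assms(11) \<phi>(1) by (simp add: normal_operator_def \<rho> Let_def)
    also have "\<dots> = 1 / real N * (\<Sum>i=1..N. LINT x|\<mu>. q x i)"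
      by (simp add: law_i)
    also have "\<dots> = (LINT x|\<mu>. 1 / real N * (\<Sum>i=1..N. q x i))"
      using q_int by simp
    also have "\<dots> = (LINT x|\<mu>. v \<bullet> (gram_matrix N n u x *\<^sub>v v))"
      by (simp add: gram_matrix_quad[OF v] q_def \<phi>u_def)
    also have "\<dots> = expectation (\<lambda>\<omega>. v \<bullet> (gram_matrix N n u (joint N (Xs m) \<omega>) *\<^sub>v v))"
    proof -
      have "(\<lambda>x. 1 / real N * (\<Sum>i=1..N. q x i)) \<in> borel_measurable (config_space N)"
        using q_meas by (intro borel_measurable_times borel_measurable_const borel_measurable_sum)
      then have "(\<lambda>x :: nat \<Rightarrow> real ^ 'd. v \<bullet> (gram_matrix N n u x *\<^sub>v v)) \<in> borel_measurable (config_space N)"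
        by (simp add: gram_matrix_quad[OF v] q_def \<phi>u_def)
      then show ?thesis
        unfolding law[OF m, symmetric] by (rule integral_distr[OF Xsm[OF m]])
    qed
    finally show ?thesis .
  qed

  interpret independent_psd_matrices P "config_space N" "\<lambda>m. joint N (Xs m)" "gram_matrix N n u" n M
    "real n * C_max\<^sup>2" c
  proof unfold_locales
    show "0 < c" using assms(12) by (simp add: coercive_def)
    show "0 < real n * C_max\<^sup>2" using C assms(4) by simp
    show "loewner_le n (gram_matrix N n u x) ((real n * C_max\<^sup>2) \<cdot>\<^sub>m 1\<^sub>m n)" for x :: "nat \<Rightarrow> real ^ 'd"
      by (rule gram_matrix_le[OF N(1) u_le])
    show "(\<lambda>x. gram_matrix N n u x $$ (k, l)) \<in> borel_measurable (config_space N)"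
      if "k < n" "l < n" for k l
      using that by (intro gram_matrix_measurable u_meas)
  qed (use assms(3,4) indep mean in \<open>auto simp: gram_matrix_sym gram_matrix_psd\<close>)
  note tail = matrix_Chernoff_lower_tail[OF _ _ H]

  \<comment> \<open>The second bound is the case \<open>\<epsilon> = 1 / 2\<close>.\<close>
  have "prob {\<omega> \<in> space P. lambda_min (normal_matrix N M n \<psi> (\<lambda>m i. Xs m i \<omega>)) \<le> c / 2}
      \<le> real n * (exp (- (1 / 2)) / (1 / 2) powr (1 / 2)) powr (c * real M / (real n * C_max\<^sup>2))"
    using tail[of "1 / 2"] by simp
  also have "exp (- (1 / 2)) / (1 / 2) powr (1 / 2) = (exp 1 / 2 :: real) powr (- (1 / 2))"
    by (simp add: powr_def exp_minus ln_div divide_simps flip: exp_add exp_diff)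
  also have "\<dots> powr (c * real M / (real n * C_max\<^sup>2))
      = (exp 1 / 2) powr (- (c * real M / (2 * real n * C_max\<^sup>2)))"
    by (simp add: powr_powr mult.assoc)
  finally show ?thesis using tail by blast
qed

end
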